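(* Let $(X,\mu)$ be a standard probability space and let $\mathcal{G}$ be a bounded-degree Borel pmp graph on $X$ with adjacency operator $T_{\mathcal{G}}$. If $\mathcal{G}$ is approximately measurably bipartite, then the spectrum of $T_{\mathcal{G}}$ is symmetric, i.e. whenever $\lambda\in\sigma(T_{\mathcal{G}})$, also $-\lambda\in\sigma(T_{\mathcal{G}})$.
   Context: A Borel graph on a standard Borel space $X$ is a simple undirected graph whose edge set is a Borel subset of $X^2$; it has bounded degree if there is $d\in\mathbb{N}$ with $\deg(x)\le d$ for all $x$ (properties are understood up to $\mu$-null sets). $\mathcal{G}$ is pmp (probability measure preserving) if every partial Borel bijection $\theta$ of $X$ whose graph is contained in the connectedness relation of $\mathcal{G}$ preserves $\mu$, i.e. $\mu(\theta^{-1}(A))=\mu(A)$ for all measurable $A$. The adjacency operator $T_{\mathcal{G}}$ on $L^2(X,\mu)$ is $(T_{\mathcal{G}}f)(x)=\sum_{y\sim x}f(y)$. A set is $\mathcal{G}$-independent if no two of its points are adjacent. $\mathcal{G}$ is approximately measurably bipartite if for every $\varepsilon>0$ there exist disjoint $\mathcal{G}$-independent measurable sets $A,B\subseteq X$ with $\mu(A\cup B)>1-\varepsilon$. *)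

theory Defs
  imports "HOL-Probability.Probability"
begin

text \<open>A standard Borel space is (up to Borel isomorphism) a Polish space with its Borel
  sigma-algebra; we model X as a type of class polish_space and require that the measure
  lives on the Borel sets.  A graph is a symmetric irreflexive relation E.\<close>

definition simple_graph :: "('a \<Rightarrow> 'a \<Rightarrow> bool) \<Rightarrow> bool" where
  "simple_graph E \<longleftrightarrow> (\<forall>x y. E x y \<longrightarrow> E y x) \<and> (\<forall>x. \<not> E x x)"

definition borel_graph :: "'a measure \<Rightarrow> ('a \<Rightarrow> 'a \<Rightarrow> bool) \<Rightarrow> bool" where
  "borel_graph M E \<longleftrightarrow> simple_graph E \<and> {(x, y). E x y} \<in> sets (M \<Otimes>\<^sub>M M)"

definition nbhd :: "('a \<Rightarrow> 'a \<Rightarrow> bool) \<Rightarrow> 'a \<Rightarrow> 'a set" where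
  "nbhd E x = {y. E x y}"

definition bounded_degree :: "'a measure \<Rightarrow> ('a \<Rightarrow> 'a \<Rightarrow> bool) \<Rightarrow> bool" where
  "bounded_degree M E \<longleftrightarrow> (\<exists>d::nat. AE x in M. finite (nbhd E x) \<and> card (nbhd E x) \<le> d)"

definition partial_borel_bij_in ::
    "'a measure \<Rightarrow> ('a \<Rightarrow> 'a \<Rightarrow> bool) \<Rightarrow> ('a \<Rightarrow> 'a) \<Rightarrow> 'a set \<Rightarrow> 'a set \<Rightarrow> bool" where
  "partial_borel_bij_in M E \<theta> A B \<longleftrightarrow>
     A \<in> sets M \<and> B \<in> sets M \<and> bij_betw \<theta> A B \<and>
     (\<forall>C \<in> sets M. \<theta> -` C \<inter> A \<in> sets M) \<and>
     (\<forall>x \<in> A. E\<^sup>*\<^sup>* x (\<theta> x))"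

definition pmp_graph :: "'a measure \<Rightarrow> ('a \<Rightarrow> 'a \<Rightarrow> bool) \<Rightarrow> bool" where
  "pmp_graph M E \<longleftrightarrow>
     (\<forall>\<theta> A B. partial_borel_bij_in M E \<theta> A B \<longrightarrow>
        (\<forall>C \<in> sets M. C \<subseteq> B \<longrightarrow> measure M (\<theta> -` C \<inter> A) = measure M C))"

definition independent_set :: "('a \<Rightarrow> 'a \<Rightarrow> bool) \<Rightarrow> 'a set \<Rightarrow> bool" where
  "independent_set E A \<longleftrightarrow> (\<forall>x \<in> A. \<forall>y \<in> A. \<not> E x y)"

definition approx_meas_bipartite :: "'a measure \<Rightarrow> ('a \<Rightarrow> 'a \<Rightarrow> bool) \<Rightarrow> bool" where
  "approx_meas_bipartite M E \<longleftrightarrow>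
     (\<forall>\<epsilon>>0. \<exists>A B. A \<in> sets M \<and> B \<in> sets M \<and> A \<inter> B = {} \<and>
        independent_set E A \<and> independent_set E B \<and> measure M (A \<union> B) > 1 - \<epsilon>)"

text \<open>L^2(X,mu) (complex scalars), represented by square-integrable measurable functions;
  elements are identified when equal almost everywhere.\<close>

definition L2 :: "'a measure \<Rightarrow> ('a \<Rightarrow> complex) set" where
  "L2 M = {f. f \<in> borel_measurable M \<and> integrable M (\<lambda>x. (cmod (f x))\<^sup>2)}"

definition L2_normsq :: "'a measure \<Rightarrow> ('a \<Rightarrow> complex) \<Rightarrow> real" where
  "L2_normsq M f = (\<integral>x. (cmod (f x))\<^sup>2 \<partial>M)"

definition ae_eq :: "'a measure \<Rightarrow> ('a \<Rightarrow> complex) \<Rightarrow> ('a \<Rightarrow> complex) \<Rightarrow> bool" where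
  "ae_eq M f g \<longleftrightarrow> (AE x in M. f x = g x)"

definition adj_op :: "('a \<Rightarrow> 'a \<Rightarrow> bool) \<Rightarrow> ('a \<Rightarrow> complex) \<Rightarrow> 'a \<Rightarrow> complex" where
  "adj_op E f x = (\<Sum>y \<in> nbhd E x. f y)"

text \<open>An operator T (acting on representatives) on L^2 has a bounded inverse if there is a
  map S on L^2, well defined on a.e.-classes, bounded in L^2-norm, and two-sided inverse to T
  on a.e.-classes.  (A two-sided inverse of a linear map is automatically linear.)\<close>

definition has_bounded_inverse_L2 ::
    "'a measure \<Rightarrow> (('a \<Rightarrow> complex) \<Rightarrow> ('a \<Rightarrow> complex)) \<Rightarrow> bool" where
  "has_bounded_inverse_L2 M T \<longleftrightarrow>
     (\<exists>S. (\<forall>f \<in> L2 M. S f \<in> L2 M) \<and>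
          (\<forall>f \<in> L2 M. \<forall>g \<in> L2 M. ae_eq M f g \<longrightarrow> ae_eq M (S f) (S g)) \<and>
          (\<forall>f \<in> L2 M. ae_eq M (T (S f)) f) \<and>
          (\<forall>f \<in> L2 M. ae_eq M (S (T f)) f) \<and>
          (\<exists>C. \<forall>f \<in> L2 M. L2_normsq M (S f) \<le> C * L2_normsq M f))"

definition L2_spectrum ::
    "'a measure \<Rightarrow> (('a \<Rightarrow> complex) \<Rightarrow> ('a \<Rightarrow> complex)) \<Rightarrow> complex set" where
  "L2_spectrum M T = {c. \<not> has_bounded_inverse_L2 M (\<lambda>f x. T f x - c * f x)}"

end

theory Submission
  imports Defs
begin

text \<open>
  By a measurable uniformization theorem the neighbourhoods of almost all points are enumerated by
  finitely many Borel partial functions; pairing these up writes the adjacency operator as a finite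
  sum of measure-preserving partial isomorphisms, hence as a bounded self-adjoint operator \<open>T\<close>.

  If \<open>T + c\<close> is invertible, it is bounded below.  Let \<open>s = 1\<^sub>A - 1\<^sub>B\<close> for an almost
  bipartition \<open>A, B\<close>.  Then \<open>(T + c) (s f) = - s (T - c) f\<close> off a small set, and letting the
  size of that set tend to 0 shows that \<open>T - c\<close> is bounded below with the same constant.  The
  same holds for the adjoint \<open>T - cnj c\<close> by complex conjugation, so \<open>T - c\<close> is invertible.

  The degree bound only holds almost everywhere, and a null set may a priori contain neighbours of
  a set of positive measure.  Excluding this is where the graph being measure preserving is used
  beyond the partial isomorphisms themselves: the fibres of a Borel map \<open>f\<close> into a null set
  contain no transversal of positive measure, so they contain perfect sets, and these provide two
  fibre-preserving injections of a set into itself with disjoint images.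
\<close>

section \<open>Borel sets as projections of closed sets\<close>

text \<open>Points of a null set carry no degree bound, so the fibres of a Borel map into it may be
  uncountable, and the map need not split into countably many injective pieces. Preservation of
  measure by injective pieces therefore does not settle the matter. The two injections do: both
  preserve measure, while their disjoint images lie in a set of the same measure as their domain.
  Invariance applies to bijections between Borel sets only, whereas projections of Borel sets are
  merely analytic. Compact sets are the remedy throughout: their continuous images are compact, and
  they exhaust a finite measure up to any positive error. Since \<open>s\<close> changes sign along
  every edge joining \<open>A\<close> and \<open>B\<close>, it anticommutes with \<open>T\<close>
  there. A bound from below is carried along instead of mere injectivity because the bound survives
  the limit. It makes the product of \<open>T - c\<close> with its adjoint invertible, and
  injectivity of the adjoint then cancels the outer factor, which yields surjectivity.\<close>

definition suslin :: "'a::topological_space set \<Rightarrow> bool" where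
  "suslin A \<longleftrightarrow> (\<exists>F :: ('a \<times> (nat \<Rightarrow> nat discrete)) set. closed F \<and> fst ` F = A)"

lemma suslin_closed: "closed A \<Longrightarrow> suslin A"
  unfolding suslin_def by (rule exI[of _ "A \<times> UNIV"]) (auto intro: closed_Times)

text \<open>Entry 0 of the new sequence records the index \<open>n\<close> and the tail is the
  witness for \<open>A n\<close>; discreteness of the index keeps the glued set closed.\<close>

lemma suslin_UN:
  fixes A :: "nat \<Rightarrow> 'a::topological_space set"
  assumes "\<And>n. suslin (A n)" shows "suslin (\<Union>n. A n)"
proof -
  obtain F :: "nat \<Rightarrow> ('a \<times> (nat \<Rightarrow> nat discrete)) set"
    where F: "\<And>n. closed (F n)" "\<And>n. fst ` F n = A n"
    using assms unfolding suslin_def by metis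
  define S where "S = (\<lambda>p :: 'a \<times> (nat \<Rightarrow> nat discrete). (fst p, \<lambda>k. snd p (Suc k)))"
  define G where "G = {p. S p \<in> F (of_discrete (snd p 0))}"
  have cS: "continuous_on UNIV S"
    unfolding S_def by (intro continuous_intros continuous_on_coordinatewise_then_product
        continuous_on_product_then_coordinatewise)
  have c0: "continuous_on UNIV (\<lambda>p :: 'a \<times> (nat \<Rightarrow> nat discrete). snd p 0)"
    by (rule continuous_on_product_then_coordinatewise[OF continuous_on_snd[OF continuous_on_id]])
  have "- G = (\<Union>n. ((\<lambda>p. snd p 0) -` {discrete n}) \<inter> S -` (- F n))"
    unfolding G_def by (auto simp: discrete_inverse of_discrete_inverse)
  moreover have "open (\<Union>n. ((\<lambda>p. snd p 0) -` {discrete n}) \<inter> S -` (- F n))"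
    using F(1) by (intro open_UN ballI open_Int open_vimage cS c0) (auto simp: open_discrete)
  ultimately have "closed G" by (simp add: closed_def)
  moreover have "fst ` G = (\<Union>n. A n)"
  proof
    show "fst ` G \<subseteq> (\<Union>n. A n)"
      unfolding G_def S_def F(2)[symmetric] by (force intro: rev_image_eqI)
    show "(\<Union>n. A n) \<subseteq> fst ` G"
    proof
      fix x assume "x \<in> (\<Union>n. A n)"
      then obtain n s where "(x, s) \<in> F n" using F(2) by fastforce
      then have "(x, case_nat (discrete n) s) \<in> G"
        by (simp add: G_def S_def discrete_inverse)
      then show "x \<in> fst ` G" by force
    qed
  qed
  ultimately show ?thesis unfolding suslin_def by blast
qed

text \<open>The witnesses for all \<open>A n\<close> are interleaved into one sequence along
  \<open>prod_encode\<close>.\<close>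

lemma suslin_INT:
  fixes A :: "nat \<Rightarrow> 'a::topological_space set"
  assumes "\<And>n. suslin (A n)" shows "suslin (\<Inter>n. A n)"
proof -
  obtain F :: "nat \<Rightarrow> ('a \<times> (nat \<Rightarrow> nat discrete)) set"
    where F: "\<And>n. closed (F n)" "\<And>n. fst ` F n = A n"
    using assms unfolding suslin_def by metis
  define S where "S = (\<lambda>n. \<lambda>p :: 'a \<times> (nat \<Rightarrow> nat discrete). (fst p, \<lambda>k. snd p (prod_encode (n, k))))"
  define G where "G = (\<Inter>n. S n -` F n)"
  have cS: "continuous_on UNIV (S n)" for n
    unfolding S_def by (intro continuous_intros continuous_on_coordinatewise_then_product
        continuous_on_product_then_coordinatewise)
  have "closed G"
    unfolding G_def using F(1) cS by (intro closed_INT ballI closed_vimage)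
  moreover have "fst ` G = (\<Inter>n. A n)"
  proof
    show "fst ` G \<subseteq> (\<Inter>n. A n)"
      unfolding G_def S_def F(2)[symmetric] by (force intro: rev_image_eqI)
    show "(\<Inter>n. A n) \<subseteq> fst ` G"
    proof
      fix x assume "x \<in> (\<Inter>n. A n)"
      then have "\<forall>n. \<exists>s. (x, s) \<in> F n" using F(2) by fastforce
      then obtain s where s: "\<And>n. (x, s n) \<in> F n" by metis
      have "(x, \<lambda>m. case prod_decode m of (n, k) \<Rightarrow> s n k) \<in> G"
        using s by (simp add: G_def S_def)
      then show "x \<in> fst ` G" by force
    qed
  qed
  ultimately show ?thesis unfolding suslin_def by blast
qed

lemma suslin_open:
  fixes A :: "'a::metric_space set"
  assumes "open A" shows "suslin A"
proof (cases "A = UNIV")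
  case False
  then have ne: "- A \<noteq> {}" by auto
  define C where "C n = {x. infdist x (- A) \<ge> 1 / Suc n}" for n :: nat
  have "closed (C n)" for n
    unfolding C_def by (intro closed_Collect_le continuous_intros)
  moreover have "A = (\<Union>n. C n)"
  proof -
    have "x \<in> A \<longleftrightarrow> infdist x (- A) > 0" for x
      using in_closed_iff_infdist_zero[OF _ ne, of x] assms infdist_nonneg[of x "-A"]
      by (auto simp: closed_def less_le)
    moreover have "infdist x (- A) > 0 \<longleftrightarrow> (\<exists>n. infdist x (- A) \<ge> 1 / Suc n)" for x
    proof
      assume "infdist x (- A) > 0"
      then obtain n where "1 / Suc n < infdist x (- A)" using nat_approx_posE by blast
      then show "\<exists>n. infdist x (- A) \<ge> 1 / Suc n" by (auto intro: less_imp_le)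
    next
      assume "\<exists>n. infdist x (- A) \<ge> 1 / Suc n"
      then obtain n where "infdist x (- A) \<ge> 1 / Suc n" ..
      then show "infdist x (- A) > 0" by (rule less_le_trans[rotated]) simp
    qed
    ultimately show ?thesis unfolding C_def by blast
  qed
  ultimately show ?thesis using suslin_UN[of C] suslin_closed by metis
qed (simp add: suslin_closed)

lemma suslin_borel:
  fixes A :: "'a::metric_space set"
  assumes "A \<in> sets borel" shows "suslin A"
proof -
  have "A \<in> sigma_sets UNIV {S. open S}" using assms by (simp add: borel_def)
  \<comment> \<open>Projections of closed sets are not stable under complements, so the induction
    carries each set together with its complement.\<close>
  then have "suslin A \<and> suslin (- A)"
  proof induction
    case (Basic a) then show ?case by (auto intro: suslin_open suslin_closed)
  next
    case Empty then show ?case by (auto intro: suslin_closed)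
  next
    case (Compl a) then show ?case by (simp add: Compl_eq_Diff_UNIV[symmetric])
  next
    case (Union a)
    then show ?case using suslin_UN[of a] suslin_INT[of "\<lambda>n. - a n"] by (simp add: Compl_UN)
  qed
  then show ?thesis ..
qed

section \<open>Compact approximation and Borel selection for continuous images\<close>

lemma dense_sequence:
  obtains d :: "nat \<Rightarrow> 'w::{metric_space, second_countable_topology}" where "\<And>x e. e > 0 \<Longrightarrow> \<exists>i. dist (d i) x < e"
proof -
  obtain D :: "'w set" where D: "countable D" "\<And>X. open X \<Longrightarrow> X \<noteq> {} \<Longrightarrow> \<exists>d\<in>D. d \<in> X"
    by (rule countable_dense_setE) blast
  then have "D \<noteq> {}" using open_UNIV by blast
  show ?thesis
  proof (rule that)
    fix x :: 'w and e :: real assume "e > 0"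
    then obtain y where "y \<in> D" "y \<in> ball x e" using D(2)[of "ball x e"] by auto
    then show "\<exists>i. dist (from_nat_into D i) x < e"
      using from_nat_into_surj[OF D(1)] by (auto simp: dist_commute)
  qed
qed

text \<open>Choquet's capacitability argument: cutting \<open>F\<close> down to finitely many small balls at every
  scale loses little outer measure by continuity along increasing sequences, and the intersection
  of all these cuts is compact.\<close>

lemma compact_approx_image:
  fixes M :: "'a::metric_space measure" and \<pi> :: "'w::{complete_space, second_countable_topology} \<Rightarrow> 'a"
  assumes M: "finite_measure M" "sets M = sets borel"
    and F: "closed F" and \<pi>: "continuous_on UNIV \<pi>"
    and b: "b < outer_measure_of M (\<pi> ` F)"
  obtains C where "compact C" "C \<subseteq> F" "b \<le> emeasure M (\<pi> ` C)"
proof -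
  interpret finite_measure M by fact
  have sp: "space M = UNIV" using sets_eq_imp_space_eq[OF M(2)] by simp
  obtain d :: "nat \<Rightarrow> 'w" where d: "\<And>x e. e > 0 \<Longrightarrow> \<exists>i. dist (d i) x < e"
    using dense_sequence by blast
  define B where "B k m = (\<Union>i\<le>m. cball (d i) (1 / Suc k))" for k m :: nat
  have "\<exists>G. \<forall>k. (closed (G k) \<and> G k \<subseteq> F \<and> b < outer_measure_of M (\<pi> ` G k))
          \<and> (\<exists>m. G (Suc k) = G k \<inter> B k m)"
  proof (rule dependent_nat_choice)
    show "\<exists>H. closed H \<and> H \<subseteq> F \<and> b < outer_measure_of M (\<pi> ` H)" using F b by auto
  next
    fix H k assume H: "closed H \<and> H \<subseteq> F \<and> b < outer_measure_of M (\<pi> ` H)"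
    have "(\<Union>m. \<pi> ` (H \<inter> B k m)) = \<pi> ` H"
    proof -
      have "x \<in> (\<Union>m. B k m)" for x
        using d[of "1 / Suc k" x] unfolding B_def by (auto intro: less_imp_le)
      then show ?thesis by (auto 5 4)
    qed
    moreover have "(SUP m. outer_measure_of M (\<pi> ` (H \<inter> B k m))) = outer_measure_of M (\<Union>m. \<pi> ` (H \<inter> B k m))"
    proof (rule SUP_outer_measure_of_incseq)
      show "incseq (\<lambda>m. \<pi> ` (H \<inter> B k m))"
        unfolding incseq_def B_def by (intro allI impI image_mono Int_mono UN_mono) auto
    qed (simp add: sp)
    ultimately have "b < (SUP m. outer_measure_of M (\<pi> ` (H \<inter> B k m)))" using H by simp
    then obtain m where "b < outer_measure_of M (\<pi> ` (H \<inter> B k m))" by (auto simp: less_SUP_iff)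
    moreover have "closed (B k m)" unfolding B_def by (intro closed_UN) auto
    ultimately show "\<exists>H'. (closed H' \<and> H' \<subseteq> F \<and> b < outer_measure_of M (\<pi> ` H')) \<and> (\<exists>m. H' = H \<inter> B k m)"
      using H by (intro exI[of _ "H \<inter> B k m"]) auto
  qed
  then obtain G m where G: "\<And>k. closed (G k)" "\<And>k. G k \<subseteq> F" "\<And>k. b < outer_measure_of M (\<pi> ` G k)"
    "\<And>k. G (Suc k) = G k \<inter> B k (m k)" by metis
  have dec: "G j \<subseteq> G i" if "i \<le> j" for i j
    using that by (rule lift_Suc_antimono_le[rotated]) (auto simp: G(4))
  have cover: "\<exists>k X. finite X \<and> G k \<subseteq> (\<Union>x\<in>X. cball x e)" if "e > 0" for e
  proof -
    obtain k where "1 / Suc k < e" using nat_approx_posE \<open>e > 0\<close> by blast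
    then have "G (Suc k) \<subseteq> (\<Union>x\<in>d ` {..m k}. cball x e)"
      unfolding G(4) B_def by (force intro: order_trans)
    then show ?thesis by blast
  qed
  define C where "C = (\<Inter>k. G k)"
  have "compact C"
    unfolding compact_eq_totally_bounded complete_eq_closed
  proof (intro conjI allI impI)
    show "closed C" unfolding C_def using G(1) by auto
    fix e :: real assume "e > 0"
    then obtain k X where X: "finite X" "G k \<subseteq> (\<Union>x\<in>X. cball x (e/2))"
      using cover[of "e/2"] half_gt_zero by blast
    have "cball x (e/2) \<subseteq> ball x e" for x :: 'w using \<open>e > 0\<close> by auto
    then have "(\<Union>x\<in>X. cball x (e/2)) \<subseteq> (\<Union>x\<in>X. ball x e)" by (rule UN_mono[OF subset_refl])
    moreover have "C \<subseteq> G k" unfolding C_def by auto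
    ultimately have "C \<subseteq> (\<Union>x\<in>X. ball x e)" using X(2) by (meson order_trans)
    then show "\<exists>X. finite X \<and> C \<subseteq> (\<Union>x\<in>X. ball x e)" using X(1) by blast
  qed
  moreover have "C \<subseteq> F" using G(2) unfolding C_def by blast
  moreover have "b \<le> emeasure M (\<pi> ` C)"
  proof -
    \<comment> \<open>The images of the \<open>G k\<close> need not be measurable, so the estimate
      passes through their closures. Nothing is lost: a point of all closures is a limit of
      \<open>\<pi> (w k)\<close> with \<open>w k \<in> G k\<close>, and the ever finer covers make
      \<open>w\<close> totally bounded, so a subsequence converges to a point of
      \<open>C\<close>.\<close>
    have sub: "(\<Inter>k. closure (\<pi> ` G k)) \<subseteq> \<pi> ` C"
    proof
      fix x assume x: "x \<in> (\<Inter>k. closure (\<pi> ` G k))"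
      have "\<exists>w\<in>G k. dist (\<pi> w) x < 1 / Suc k" for k
        using x closure_approachable[of x "\<pi> ` G k"] by force
      then obtain w where w: "\<And>k. w k \<in> G k" "\<And>k. dist (\<pi> (w k)) x < 1 / Suc k" by metis
      have "compact (closure (range w))"
        unfolding compact_eq_totally_bounded complete_eq_closed
      proof (intro conjI allI impI)
        show "closed (closure (range w))" by simp
        fix e :: real assume "e > 0"
        then obtain k X where X: "finite X" "G k \<subseteq> (\<Union>x\<in>X. cball x (e/2))"
          using cover[of "e/2"] half_gt_zero by blast
        let ?Y = "X \<union> w ` {..k}"
        have "range w \<subseteq> (\<Union>x\<in>?Y. cball x (e/2))"
        proof
          fix y assume "y \<in> range w"
          then obtain j where j: "y = w j" by auto
          show "y \<in> (\<Union>x\<in>?Y. cball x (e/2))"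
          proof (cases "j \<le> k")
            case True then show ?thesis using j \<open>e > 0\<close> by (intro UN_I[of y]) auto
          next
            case False then have "y \<in> G k" using w(1)[of j] dec[of k j] j by auto
            then show ?thesis using X by blast
          qed
        qed
        then have "closure (range w) \<subseteq> (\<Union>x\<in>?Y. cball x (e/2))"
          using X(1) by (intro closure_minimal closed_UN) auto
        moreover have "cball x (e/2) \<subseteq> ball x e" for x :: 'w using \<open>e > 0\<close> by auto
        then have "(\<Union>x\<in>?Y. cball x (e/2)) \<subseteq> (\<Union>x\<in>?Y. ball x e)" by (rule UN_mono[OF subset_refl])
        ultimately have "closure (range w) \<subseteq> (\<Union>x\<in>?Y. ball x e)" by (rule order_trans)
        then show "\<exists>X. finite X \<and> closure (range w) \<subseteq> (\<Union>x\<in>X. ball x e)"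
          using X(1) by (intro exI[of _ ?Y]) auto
      qed
      then have "seq_compact (closure (range w))" by (simp add: compact_eq_seq_compact_metric)
      then obtain l r where r: "strict_mono r" "(w \<circ> r) \<longlonglongrightarrow> l"
        by (rule seq_compactE[of _ w]) (auto intro: subsetD[OF closure_subset])
      have "l \<in> G k" for k
      proof (rule Lim_in_closed_set[OF G(1) _ _ r(2)])
        have "w (r n) \<in> G k" if "n \<ge> k" for n
          using dec[of k "r n"] w(1)[of "r n"] seq_suble[OF r(1), of n] that by auto
        then show "\<forall>\<^sub>F n in sequentially. (w \<circ> r) n \<in> G k" by (auto intro: eventually_sequentiallyI)
      qed simp
      then have "l \<in> C" unfolding C_def by auto
      have "(\<lambda>n. \<pi> (w (r n))) \<longlonglongrightarrow> \<pi> l"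
        using continuous_on_tendsto_compose[OF \<pi> r(2)] by (simp add: o_def)
      moreover have "(\<lambda>n. \<pi> (w n)) \<longlonglongrightarrow> x"
      proof (rule metric_tendsto_imp_tendsto[OF LIMSEQ_inverse_real_of_nat])
        show "\<forall>\<^sub>F n in sequentially. dist (\<pi> (w n)) x \<le> dist (inverse (real (Suc n))) 0"
          using w(2) by (auto simp: dist_real_def field_simps intro!: always_eventually less_imp_le)
      qed
      ultimately have "\<pi> l = x"
        using LIMSEQ_unique LIMSEQ_subseq_LIMSEQ[OF _ r(1), of "\<lambda>n. \<pi> (w n)" x] by (auto simp: o_def)
      with \<open>l \<in> C\<close> show "x \<in> \<pi> ` C" by auto
    qed
    have "b \<le> (INF k. emeasure M (closure (\<pi> ` G k)))"
    proof (rule INF_greatest)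
      fix k
      have "b < outer_measure_of M (\<pi> ` G k)" by (rule G(3))
      also have "\<dots> \<le> outer_measure_of M (closure (\<pi> ` G k))"
        by (intro outer_measure_of_mono closure_subset)
      also have "\<dots> = emeasure M (closure (\<pi> ` G k))" by (simp add: M(2))
      finally show "b \<le> emeasure M (closure (\<pi> ` G k))" by simp
    qed
    also have "\<dots> = emeasure M (\<Inter>k. closure (\<pi> ` G k))"
      by (rule INF_emeasure_decseq)
         (auto simp: M(2) decseq_def emeasure_eq_measure intro!: closure_mono image_mono dec dest: dec)
    also have "\<dots> \<le> emeasure M (\<pi> ` C)"
      by (intro emeasure_mono sub)
        (simp add: M(2) borel_closed compact_imp_closed compact_continuous_image continuous_on_subset[OF \<pi>] \<open>compact C\<close>)
    finally show ?thesis .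
  qed
  ultimately show ?thesis using that by blast
qed

text \<open>At each scale the selector takes the least-numbered ball whose intersection with
  \<open>C\<close> and the earlier balls still meets the fibre. These intersections are compact and
  so have closed images, which makes every choice Borel in \<open>x\<close>; the selected point is
  the limit of the centres.\<close>

lemma compact_borel_selection:
  fixes \<pi> :: "'w::{complete_space, second_countable_topology} \<Rightarrow> 'a::metric_space"
  assumes C: "compact C" and \<pi>: "continuous_on UNIV \<pi>"
  obtains s where "s \<in> borel_measurable borel" "\<And>x. x \<in> \<pi> ` C \<Longrightarrow> s x \<in> C \<and> \<pi> (s x) = x"
proof -
  obtain d :: "nat \<Rightarrow> 'w" where d: "\<And>x e. e > 0 \<Longrightarrow> \<exists>i. dist (d i) x < e"
    using dense_sequence by blast
  define S where "S w = C \<inter> (\<Inter>j\<in>{..<length w}. cball (d (w ! j)) (1 / Suc j))" for w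
  have S_compact: "compact (S w)" for w
    unfolding S_def by (intro compact_Int_closed C closed_INT) auto
  have [measurable]: "\<pi> ` S w \<in> sets borel" for w
    by (intro borel_closed compact_imp_closed compact_continuous_image continuous_on_subset[OF \<pi>] S_compact) auto
  have S_snoc: "S (w @ [i]) = S w \<inter> cball (d i) (1 / Suc (length w))" for w i
    by (simp add: S_def lessThan_Suc nth_append Int_ac cong: INF_cong_simp)
  define u where "u x = rec_nat [] (\<lambda>k w. w @ [LEAST i. x \<in> \<pi> ` S (w @ [i])])" for x
  have u0: "u x 0 = []" and uS: "u x (Suc k) = u x k @ [LEAST i. x \<in> \<pi> ` S (u x k @ [i])]" for x k
    by (auto simp: u_def)
  have u_len: "length (u x k) = k" for x k by (induction k) (auto simp: u0 uS)
  have u_meas: "(\<lambda>x. u x k) \<in> measurable borel (count_space UNIV)" for k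
  proof (induction k)
    case (Suc k)
    have "(\<lambda>x. w @ [LEAST i. x \<in> \<pi> ` S (w @ [i])]) \<in> measurable borel (count_space UNIV)" for w
      by measurable
    from measurable_compose_countable[OF this Suc] show ?case unfolding uS .
  qed (simp add: u0)
  have u_in: "x \<in> \<pi> ` S (u x k)" if "x \<in> \<pi> ` C" for x k
  proof (induction k)
    case 0 then show ?case using that by (simp add: u0 S_def)
  next
    case (Suc k)
    then obtain p where p: "p \<in> S (u x k)" "x = \<pi> p" by auto
    obtain i where "dist (d i) p < 1 / Suc k" using d[of "1 / Suc k" p] by auto
    then have "x \<in> \<pi> ` S (u x k @ [i])" unfolding S_snoc using p by (auto simp: u_len intro: less_imp_le)
    then show ?case unfolding uS by (rule LeastI)
  qed
  have ex: "\<exists>p\<in>C. \<pi> p = x \<and> (\<lambda>k. d (last (u x (Suc k)))) \<longlonglongrightarrow> p" if x: "x \<in> \<pi> ` C" for x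
  proof -
    define Q where "Q k = \<pi> -` {x} \<inter> (\<Inter>j\<in>{..<k}. cball (d (u x k ! j)) (1 / Suc j))" for k
    have uS': "u x k = take k (u x j)" if "k \<le> j" for k j
      using that by (induction rule: dec_induct) (auto simp: uS u_len)
    have Qdec: "Q j \<subseteq> Q k" if "k \<le> j" for k j
      unfolding Q_def uS'[OF that] using that by auto
    have "C \<inter> (\<Inter>k\<in>UNIV. Q k) \<noteq> {}"
    proof (rule compact_imp_fip_image[OF C])
      show "closed (Q k)" for k
        unfolding Q_def by (intro closed_Int closed_vimage \<pi> closed_INT) auto
      fix I :: "nat set" assume "finite I"
      then obtain N where N: "\<And>i. i \<in> I \<Longrightarrow> i \<le> N" by (meson finite_nat_set_iff_bounded_le)
      have "C \<inter> Q N \<noteq> {}" using u_in[OF x, of N] unfolding S_def Q_def u_len by auto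
      then show "C \<inter> (\<Inter>k\<in>I. Q k) \<noteq> {}" using Qdec[OF N] by blast
    qed
    then obtain p where p: "p \<in> C" "\<And>k. p \<in> Q k" by auto
    have "dist (d (last (u x (Suc k)))) p \<le> 1 / Suc k" for k
    proof -
      have "last (u x (Suc k)) = u x (Suc k) ! k" by (simp add: uS nth_append u_len)
      then show ?thesis using p(2)[of "Suc k"] unfolding Q_def by auto
    qed
    then have "(\<lambda>k. d (last (u x (Suc k)))) \<longlonglongrightarrow> p"
      by (intro metric_tendsto_imp_tendsto[OF LIMSEQ_inverse_real_of_nat])
         (auto simp: dist_real_def inverse_eq_divide)
    then show ?thesis using p(1) p(2)[of 0] by (auto simp: Q_def)
  qed
  then obtain p where p: "\<And>x. x \<in> \<pi> ` C \<Longrightarrow> p x \<in> C \<and> \<pi> (p x) = x \<and> (\<lambda>k. d (last (u x (Suc k)))) \<longlonglongrightarrow> p x"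
    by metis
  have [measurable]: "\<pi> ` C \<in> sets borel"
    by (intro borel_closed compact_imp_closed compact_continuous_image continuous_on_subset[OF \<pi>] C) auto
  have "(\<lambda>x. if x \<in> \<pi> ` C then p x else d 0) \<in> borel_measurable borel"
  proof (rule borel_measurable_LIMSEQ_metric)
    show "(\<lambda>k. if x \<in> \<pi> ` C then d (last (u x (Suc k))) else d 0) \<longlonglongrightarrow> (if x \<in> \<pi> ` C then p x else d 0)" for x
      using p by auto
    have "(\<lambda>x. d (last (u x (Suc k)))) \<in> borel_measurable borel" for k
      using measurable_compose[OF u_meas[of "Suc k"], of "\<lambda>w. d (last w)" borel] by simp
    then show "(\<lambda>x. if x \<in> \<pi> ` C then d (last (u x (Suc k))) else d 0) \<in> borel_measurable borel" for k
      by measurable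
  qed
  then show ?thesis using p by (intro that[of "\<lambda>x. if x \<in> \<pi> ` C then p x else d 0"]) auto
qed

section \<open>Lusin's theorem and uniformization almost everywhere\<close>

lemma borel_measurable_fst_snd [measurable]:
  "fst \<in> borel_measurable borel" "snd \<in> borel_measurable borel"
  by (intro borel_measurable_continuous_onI continuous_intros)+

text \<open>A function with compact graph is continuous. The graph of \<open>g\<close> over
  \<open>A\<close> is Borel, hence the projection of a closed set, and a compact part of that set
  projects onto a compact piece of the graph lying over most of \<open>A\<close>.\<close>

theorem lusin:
  fixes M :: "'a::polish_space measure" and g :: "'a \<Rightarrow> 'b::{complete_space, second_countable_topology}"
  assumes M: "finite_measure M" "sets M = sets borel"
    and A: "A \<in> sets borel" and g[measurable]: "g \<in> borel_measurable borel" and "e > 0"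
  obtains K where "compact K" "K \<subseteq> A" "continuous_on K g" "measure M (A - K) < e"
\<comment> \<open>Outside this case \<open>measure M A - e / 2\<close> is positive, so
  \<open>ennreal\<close> does not truncate it.\<close>
proof (cases "measure M A < e")
  case True
  then show ?thesis by (intro that[of "{}"]) auto
next
  case False
  interpret finite_measure M by fact
  define E where "E = {p \<in> space borel. fst p \<in> A \<and> snd p = g (fst p)}"
  note [measurable] = A
  have "E \<in> sets borel" unfolding E_def by measurable
  then obtain F :: "(('a \<times> 'b) \<times> (nat \<Rightarrow> nat discrete)) set" where F: "closed F" "fst ` F = E"
    using suslin_borel unfolding suslin_def by metis
  define \<pi> where "\<pi> p = fst (fst p)" for p :: "('a \<times> 'b) \<times> (nat \<Rightarrow> nat discrete)"
  have c\<pi>: "continuous_on UNIV \<pi>" unfolding \<pi>_def by (intro continuous_intros)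
  have "\<pi> ` F = fst ` (fst ` F)" by (simp add: \<pi>_def image_image)
  also have "\<dots> = A" unfolding F(2) E_def by (auto simp: image_iff)
  finally have "\<pi> ` F = A" .
  then have "ennreal (measure M A - e / 2) < outer_measure_of M (\<pi> ` F)"
    using A M(2) False \<open>e > 0\<close> by (simp add: emeasure_eq_measure ennreal_less_iff)
  from compact_approx_image[OF M F(1) c\<pi> this]
  obtain C where C: "compact C" "C \<subseteq> F" "ennreal (measure M A - e / 2) \<le> emeasure M (\<pi> ` C)" .
  define K where "K = \<pi> ` C"
  have "compact K" unfolding K_def by (intro compact_continuous_image continuous_on_subset[OF c\<pi>] C) auto
  then have KM: "K \<in> sets M" by (simp add: M(2) borel_closed compact_imp_closed)
  have "K \<subseteq> A" using C(2) \<open>\<pi> ` F = A\<close> unfolding K_def by auto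
  have CE: "fst ` C \<subseteq> E" using C(2) F(2) by auto
  have "continuous_on K g"
  proof (rule continuous_on_closed_vimage[OF compact_imp_closed[OF \<open>compact K\<close>], THEN iffD2], intro allI impI)
    fix B :: "'b set" assume "closed B"
    have "g -` B \<inter> K = fst ` (fst ` C \<inter> snd -` B)"
    proof
      show "g -` B \<inter> K \<subseteq> fst ` (fst ` C \<inter> snd -` B)"
      proof
        fix x assume x: "x \<in> g -` B \<inter> K"
        then obtain q where "q \<in> C" "x = fst (fst q)" unfolding K_def \<pi>_def by auto
        then obtain p where p: "p \<in> fst ` C" "x = fst p" by blast
        with CE have "snd p = g x" unfolding E_def by auto
        with x p show "x \<in> fst ` (fst ` C \<inter> snd -` B)" by auto
      qed
      show "fst ` (fst ` C \<inter> snd -` B) \<subseteq> g -` B \<inter> K"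
        using CE unfolding E_def K_def \<pi>_def by force
    qed
    moreover have "compact (fst ` (fst ` C \<inter> snd -` B))"
      by (intro compact_continuous_image compact_Int_closed closed_vimage \<open>closed B\<close> C continuous_intros)
    ultimately show "closed (g -` B \<inter> K)" by (simp add: compact_imp_closed)
  qed
  moreover have "measure M (A - K) < e"
  proof -
    have "measure M A - e / 2 \<le> measure M K"
      using C(3) unfolding K_def[symmetric] by (simp add: emeasure_eq_measure ennreal_le_iff)
    then show ?thesis
      using finite_measure_Diff[of A K] A KM M(2) \<open>K \<subseteq> A\<close> \<open>e > 0\<close> by simp
  qed
  ultimately show ?thesis using that \<open>compact K\<close> \<open>K \<subseteq> A\<close> by blast
qed

text \<open>The domain of \<open>E\<close> is only analytic. It is exhausted by countably many
  compact images, each carrying a Borel selector, and the selectors are patched by least index.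
  Their union \<open>D\<close> has the measure of a measurable hull \<open>H\<close> of the domain,
  so what \<open>D\<close> misses lies in a null set.\<close>

theorem ae_uniformization:
  fixes M :: "'a::polish_space measure" and E :: "('a \<times> 'b::{complete_space, second_countable_topology}) set"
  assumes M: "finite_measure M" "sets M = sets borel" and E: "E \<in> sets borel"
  obtains D f where "D \<in> sets borel" "f \<in> borel_measurable borel"
    "\<And>x. x \<in> D \<Longrightarrow> (x, f x) \<in> E" "AE x in M. x \<notin> D \<longrightarrow> E `` {x} = {}"
proof -
  interpret finite_measure M by fact
  have sp: "space M = UNIV" using sets_eq_imp_space_eq[OF M(2)] by simp
  obtain F :: "(('a \<times> 'b) \<times> (nat \<Rightarrow> nat discrete)) set" where F: "closed F" "fst ` F = E"
    using suslin_borel[OF E] unfolding suslin_def by metis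
  define \<pi> where "\<pi> p = fst (fst p)" for p :: "('a \<times> 'b) \<times> (nat \<Rightarrow> nat discrete)"
  have c\<pi>: "continuous_on UNIV \<pi>" unfolding \<pi>_def by (intro continuous_intros)
  obtain H where H: "H \<in> sets M" "\<pi> ` F \<subseteq> H" "outer_measure_of M (\<pi> ` F) = emeasure M H"
    using outer_measure_of_attain[of "\<pi> ` F" M] sp by auto
  have "\<exists>C. compact C \<and> C \<subseteq> F \<and> measure M H - 1 / Suc n \<le> measure M (\<pi> ` C)" for n :: nat
  proof (cases "0 < measure M H")
    case True
    then have "ennreal (measure M H - 1 / Suc n) < outer_measure_of M (\<pi> ` F)"
      unfolding H emeasure_eq_measure by (intro ennreal_lessI) auto
    then obtain K where "compact K" "K \<subseteq> F" "ennreal (measure M H - 1 / Suc n) \<le> emeasure M (\<pi> ` K)"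
      by (rule compact_approx_image[OF M F(1) c\<pi>])
    then show ?thesis by (auto simp: emeasure_eq_measure ennreal_le_iff)
  next
    case False
    then show ?thesis by (intro exI[of _ "{}"]) (simp add: zero_less_measure_iff)
  qed
  then obtain C where C: "\<And>n. compact (C n)" "\<And>n. C n \<subseteq> F"
    "\<And>n. measure M H - 1 / Suc n \<le> measure M (\<pi> ` C n)" by metis
  have "\<exists>s. s \<in> borel_measurable borel \<and> (\<forall>x \<in> \<pi> ` C n. s x \<in> C n \<and> \<pi> (s x) = x)" for n
    using compact_borel_selection[OF C(1) c\<pi>] by metis
  then obtain s where s[measurable]: "\<And>n. s n \<in> borel_measurable borel"
     and s': "\<And>n x. x \<in> \<pi> ` C n \<Longrightarrow> s n x \<in> C n \<and> \<pi> (s n x) = x" by metis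
  have KM[measurable]: "\<pi> ` C n \<in> sets borel" for n
    by (intro borel_closed compact_imp_closed compact_continuous_image continuous_on_subset[OF c\<pi>] C) auto
  define D where "D = (\<Union>n. \<pi> ` C n)"
  define f where "f x = snd (fst (s (LEAST n. x \<in> \<pi> ` C n) x))" for x
  have D: "D \<in> sets borel" unfolding D_def by measurable
  moreover have "f \<in> borel_measurable borel"
  proof -
    have "(\<lambda>x. s (LEAST n. x \<in> \<pi> ` C n) x) \<in> borel_measurable borel"
      by (rule measurable_compose_countable[OF s]) measurable
    moreover have "(\<lambda>p :: ('a \<times> 'b) \<times> (nat \<Rightarrow> nat discrete). snd (fst p)) \<in> borel_measurable borel"
      by (intro borel_measurable_continuous_onI continuous_intros)
    ultimately show ?thesis unfolding f_def by (rule measurable_compose)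
  qed
  moreover have "(x, f x) \<in> E" if "x \<in> D" for x
  proof -
    define n where "n = (LEAST n. x \<in> \<pi> ` C n)"
    have "x \<in> \<pi> ` C n" using that unfolding n_def D_def by (auto intro: LeastI)
    from s'[OF this] have "s n x \<in> F" "fst (fst (s n x)) = x" using C(2) by (auto simp: \<pi>_def)
    then have "(x, f x) = fst (s n x)" unfolding f_def n_def[symmetric] by (simp add: prod_eq_iff)
    with \<open>s n x \<in> F\<close> show ?thesis unfolding F(2)[symmetric] by (simp add: image_eqI)
  qed
  moreover have "AE x in M. x \<notin> D \<longrightarrow> E `` {x} = {}"
  proof (rule AE_I')
    have DH: "D \<subseteq> H" using C(2) H(2) unfolding D_def by blast
    have "measure M H \<le> measure M D"
    proof (rule field_le_epsilon)
      fix e :: real assume "e > 0"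
      then obtain n where "1 / Suc n < e" using nat_approx_posE by blast
      moreover have "measure M (\<pi> ` C n) \<le> measure M D"
        using D M(2) by (intro finite_measure_mono) (auto simp: D_def)
      ultimately show "measure M H \<le> measure M D + e" using C(3)[of n] by linarith
    qed
    then have "measure M (H - D) = 0"
      using finite_measure_Diff[OF H(1) _ DH] D M(2) finite_measure_mono[OF DH H(1)] by simp
    then show "H - D \<in> null_sets M" using H D M(2) by (simp add: null_sets_def emeasure_eq_measure)
    show "{x \<in> space M. \<not> (x \<notin> D \<longrightarrow> E `` {x} = {})} \<subseteq> H - D"
    proof
      fix x assume "x \<in> {x \<in> space M. \<not> (x \<notin> D \<longrightarrow> E `` {x} = {})}"
      then obtain y where "(x, y) \<in> E" "x \<notin> D" by auto
      then have "x \<in> \<pi> ` F" unfolding F(2)[symmetric] \<pi>_def by force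
      then show "x \<in> H - D" using H(2) \<open>x \<notin> D\<close> by auto
    qed
  qed
  ultimately show ?thesis using that by blast
qed

text \<open>Removing the graph of one selector takes a point away from almost every nonempty fibre
  and keeps the later selectors distinct from it, so induction on the degree bound applies.\<close>

lemma enumerate_bounded_sections:
  fixes M :: "'a::polish_space measure" and E :: "('a \<times> 'b::{complete_space, second_countable_topology}) set"
  assumes M: "finite_measure M" "sets M = sets borel"
    and "E \<in> sets borel" "AE x in M. finite (E `` {x}) \<and> card (E `` {x}) \<le> d"
  shows "\<exists>D f. (\<forall>i. D i \<in> sets borel \<and> f i \<in> borel_measurable borel \<and> (\<forall>x\<in>D i. (x, f i x) \<in> E)) \<and>
     (\<forall>i j x. x \<in> D i \<longrightarrow> x \<in> D j \<longrightarrow> f i x = f j x \<longrightarrow> i = j) \<and>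
     (AE x in M. \<forall>y. (x, y) \<in> E \<longrightarrow> (\<exists>i<d. x \<in> D i \<and> y = f i x))"
  using assms(3-)
proof (induction d arbitrary: E)
  case 0
  have "AE x in M. \<forall>y. (x, y) \<notin> E" using 0(2) by eventually_elim auto
  then show ?case by (intro exI[of _ "\<lambda>_. {}"] exI[of _ "\<lambda>_ _. undefined"]) auto
next
  case (Suc d)
  obtain D0 f0 where D0: "D0 \<in> sets borel" "f0 \<in> borel_measurable borel"
    "\<And>x. x \<in> D0 \<Longrightarrow> (x, f0 x) \<in> E" "AE x in M. x \<notin> D0 \<longrightarrow> E `` {x} = {}"
    using ae_uniformization[OF M Suc.prems(1)] by blast
  define E' where "E' = {p \<in> space borel. p \<in> E \<and> \<not> (fst p \<in> D0 \<and> snd p = f0 (fst p))}"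
  note [measurable] = D0(1,2) Suc.prems(1)
  have "E' \<in> sets borel" unfolding E'_def by measurable
  moreover have "AE x in M. finite (E' `` {x}) \<and> card (E' `` {x}) \<le> d"
    using Suc.prems(2) D0(4)
  proof eventually_elim
    case (elim x)
    show ?case
    proof (cases "x \<in> D0")
      case True
      then have "E' `` {x} = E `` {x} - {f0 x}" "f0 x \<in> E `` {x}" using D0(3) by (auto simp: E'_def)
      then have "card (E' `` {x}) = card (E `` {x}) - 1" by (simp add: card_Diff_singleton)
      moreover have "card (E `` {x}) - 1 \<le> d" using elim by linarith
      ultimately show ?thesis using elim \<open>E' `` {x} = _\<close> by simp
    next
      case False
      with elim have "E `` {x} = {}" by blast
      moreover have "E' `` {x} \<subseteq> E `` {x}" by (auto simp: E'_def)
      ultimately show ?thesis by simp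
    qed
  qed
  ultimately obtain D f where Df0: "\<forall>i. D i \<in> sets borel \<and> f i \<in> borel_measurable borel \<and> (\<forall>x\<in>D i. (x, f i x) \<in> E')"
    "\<forall>i j x. x \<in> D i \<longrightarrow> x \<in> D j \<longrightarrow> f i x = f j x \<longrightarrow> i = j"
    "AE x in M. \<forall>y. (x, y) \<in> E' \<longrightarrow> (\<exists>i<d. x \<in> D i \<and> y = f i x)"
    using Suc.IH[of E'] by auto
  note Df = Df0(1)[rule_format, THEN conjunct1] Df0(1)[rule_format, THEN conjunct2, THEN conjunct1]
    Df0(1)[rule_format, THEN conjunct2, THEN conjunct2, rule_format] Df0(2)[rule_format] Df0(3)
  have inE: "(x, f i x) \<in> E \<and> (x \<in> D0 \<longrightarrow> f i x \<noteq> f0 x)" if "x \<in> D i" for x i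
    using Df(3)[OF that] by (auto simp: E'_def)
  show ?case
  proof (intro exI conjI allI impI ballI)
    fix i
    show "case_nat D0 D i \<in> sets borel" using D0 Df by (cases i) auto
    show "case_nat f0 f i \<in> borel_measurable borel" using D0 Df by (cases i) auto
    show "(x, case_nat f0 f i x) \<in> E" if "x \<in> case_nat D0 D i" for x
      using that D0(3) inE by (cases i) auto
    show "i = j" if "x \<in> case_nat D0 D i" "x \<in> case_nat D0 D j" "case_nat f0 f i x = case_nat f0 f j x" for j x
      using that inE Df(4) by (cases i; cases j) (auto, metis+)
    show "AE x in M. \<forall>y. (x, y) \<in> E \<longrightarrow> (\<exists>i<Suc d. x \<in> case_nat D0 D i \<and> y = case_nat f0 f i x)"
      using Df(5)
    proof eventually_elim
      case (elim x)
      show ?case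
      proof (intro allI impI)
        fix y assume "(x, y) \<in> E"
        then consider "x \<in> D0 \<and> y = f0 x" | "(x, y) \<in> E'" by (auto simp: E'_def)
        then show "\<exists>i<Suc d. x \<in> case_nat D0 D i \<and> y = case_nat f0 f i x"
        proof cases
          case 1 then show ?thesis by (intro exI[of _ 0]) auto
        next
          case 2
          with elim obtain i where "i < d" "x \<in> D i" "y = f i x" by blast
          then show ?thesis by (intro exI[of _ "Suc i"]) auto
        qed
      qed
    qed
  qed
qed

section \<open>Smooth subrelations of a measure-preserving graph\<close>

text \<open>An injective Borel map falls under \<open>pmp_graph\<close> once its image is known to
  be Borel. On a compact set where the map is continuous the image is compact, and Lusin's theorem
  finds such a set with a loss below \<open>e\<close>.\<close>

lemma pmp_graph_image:
  fixes M :: "'a::polish_space measure"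
  assumes M: "finite_measure M" "sets M = sets borel" and pmp: "pmp_graph M E"
    and A: "A \<in> sets borel" and \<theta>: "\<theta> \<in> borel_measurable borel" "inj_on \<theta> A"
    and conn: "\<And>x. x \<in> A \<Longrightarrow> E\<^sup>*\<^sup>* x (\<theta> x)" and "e > 0"
  obtains K where "K \<subseteq> A" "K \<in> sets borel" "measure M (A - K) < e"
    "\<theta> ` K \<in> sets borel" "measure M (\<theta> ` K) = measure M K"
proof -
  obtain K where K: "compact K" "K \<subseteq> A" "continuous_on K \<theta>" "measure M (A - K) < e"
    using lusin[OF M A \<theta>(1) \<open>e > 0\<close>] by blast
  have KB: "K \<in> sets borel" "\<theta> ` K \<in> sets borel"
    using K by (auto intro!: borel_closed compact_imp_closed compact_continuous_image)
  have "partial_borel_bij_in M E \<theta> K (\<theta> ` K)"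
    unfolding partial_borel_bij_in_def M(2)
    using KB K(2) conn inj_on_subset[OF \<theta>(2) K(2)] measurable_sets_borel[OF \<theta>(1)]
    by (auto simp: bij_betw_def)
  then have "measure M (\<theta> -` (\<theta> ` K) \<inter> K) = measure M (\<theta> ` K)"
    using pmp KB unfolding pmp_graph_def M(2) by blast
  moreover have "\<theta> -` (\<theta> ` K) \<inter> K = K" by auto
  ultimately show ?thesis using that K KB by metis
qed

text \<open>\<open>P\<close> is the set where the conditional probability of \<open>S\<close> given \<open>f\<close> is positive.\<close>

lemma essential_image:
  fixes f :: "'a \<Rightarrow> 'b"
  assumes "finite_measure M" and f[measurable]: "f \<in> M \<rightarrow>\<^sub>M N"
    and K[measurable]: "K \<in> sets M" and S[measurable]: "S \<in> sets M" and "S \<subseteq> K"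
  obtains P where "P \<in> sets N" "AE x in M. x \<in> S \<longrightarrow> f x \<in> P"
    "\<And>Z. Z \<in> sets N \<Longrightarrow> Z \<subseteq> P \<Longrightarrow> AE x in M. x \<in> S \<longrightarrow> f x \<notin> Z \<Longrightarrow> AE x in M. x \<in> K \<longrightarrow> f x \<notin> Z"
proof -
  interpret finite_measure M by fact
  define \<nu> where "\<nu> S = distr (density M (indicator S)) N f" for S
  have sets_\<nu>[simp, measurable_cong]: "sets (\<nu> S) = sets N" for S by (simp add: \<nu>_def)
  have null: "Z \<in> null_sets (\<nu> S) \<longleftrightarrow> (AE x in M. x \<in> S \<longrightarrow> f x \<notin> Z)"
    if [measurable]: "S \<in> sets M" "Z \<in> sets N" for S Z
  proof -
    have f': "f \<in> density M (indicator S) \<rightarrow>\<^sub>M N" by measurable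
    have "Z \<in> null_sets (\<nu> S) \<longleftrightarrow> f -` Z \<inter> space M \<in> null_sets (density M (indicator S))"
      unfolding \<nu>_def null_sets_distr_iff[OF f'] using that by simp
    also have "\<dots> \<longleftrightarrow> (AE x in M. x \<in> f -` Z \<inter> space M \<longrightarrow> indicator S x = (0::ennreal))"
      by (subst null_sets_density_iff) auto
    also have "\<dots> \<longleftrightarrow> (AE x in M. x \<in> S \<longrightarrow> f x \<notin> Z)"
      by (intro AE_cong) (auto simp: indicator_def)
    finally show ?thesis .
  qed
  have "finite_measure (\<nu> K)"
    unfolding \<nu>_def by (intro finite_measure.finite_measure_distr finite_measure_restricted) auto
  then interpret K: finite_measure "\<nu> K" .
  have ac: "absolutely_continuous (\<nu> K) (\<nu> S)"
    unfolding absolutely_continuous_def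
  proof
    fix Z assume Z: "Z \<in> null_sets (\<nu> K)"
    then have "Z \<in> sets N" by auto
    with Z show "Z \<in> null_sets (\<nu> S)"
      using \<open>S \<subseteq> K\<close> by (auto simp: null elim!: eventually_mono)
  qed
  \<comment> \<open>The function \<open>h\<close> is a density of the image of \<open>M\<close> on
    \<open>S\<close> with respect to the image of \<open>M\<close> on \<open>K\<close>. A subset of
    \<open>P\<close> that is null for the first image measure is therefore null for the second,
    which is the last claim.\<close>
  define h where "h = RN_deriv (\<nu> K) (\<nu> S)"
  have h[measurable]: "h \<in> borel_measurable N"
    using borel_measurable_RN_deriv[of "\<nu> K" "\<nu> S"] unfolding h_def by simp
  have dens: "density (\<nu> K) h = \<nu> S"
    unfolding h_def by (rule K.density_RN_deriv[OF ac]) simp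
  define P where "P = {n \<in> space N. h n \<noteq> 0}"
  have [measurable]: "P \<in> sets N" unfolding P_def by measurable
  show thesis
  proof (rule that[of P])
    have "space N - P \<in> null_sets (density (\<nu> K) h)"
      by (subst null_sets_density_iff) (auto simp: P_def)
    then have "AE x in M. x \<in> S \<longrightarrow> f x \<notin> space N - P" unfolding dens by (subst (asm) null) auto
    moreover have "AE x in M. f x \<in> space N" using measurable_space[OF f] by auto
    ultimately show "AE x in M. x \<in> S \<longrightarrow> f x \<in> P" by eventually_elim auto
    fix Z assume Z: "Z \<in> sets N" "Z \<subseteq> P" "AE x in M. x \<in> S \<longrightarrow> f x \<notin> Z"
    then have "Z \<in> null_sets (density (\<nu> K) h)" unfolding dens by (subst null) auto
    then have "AE n in \<nu> K. n \<in> Z \<longrightarrow> h n = 0" by (subst (asm) null_sets_density_iff) auto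
    then have "AE n in \<nu> K. n \<notin> Z" using Z(2) by (auto simp: P_def elim!: eventually_mono)
    then have "Z \<in> null_sets (\<nu> K)" using Z(1) by (subst AE_iff_null_sets) auto
    then show "AE x in M. x \<in> K \<longrightarrow> f x \<notin> Z" using Z(1) by (subst (asm) null) auto
  qed fact
qed

section \<open>Binary trees inside the fibres of a Borel map\<close>

definition cyl :: "(nat \<Rightarrow> 'a set) \<Rightarrow> bool list \<Rightarrow> 'a set" where
  "cyl V w = {x. \<forall>i<length w. (x \<in> V i) = w ! i}"

text \<open>Equal length of two distinct words makes their cylinders disjoint, and strict extension
  makes the words along a branch grow beyond every length.\<close>

definition splits :: "bool list \<Rightarrow> bool list \<times> bool list \<Rightarrow> bool" where
  "splits w p \<longleftrightarrow> length (fst p) = length (snd p) \<and> length w < length (fst p) \<and>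
     take (length w) (fst p) = w \<and> take (length w) (snd p) = w \<and> fst p \<noteq> snd p"

lemma cyl_unique: "x \<in> cyl V v \<Longrightarrow> x \<in> cyl V w \<Longrightarrow> length v = length w \<Longrightarrow> v = w"
  by (auto simp: cyl_def intro: nth_equalityI)

lemma cyl_take: "take (length w) v = w \<Longrightarrow> cyl V v \<subseteq> cyl V w"
  unfolding cyl_def by (auto, (metis length_take min_less_iff_conj nth_take)+)

text \<open>For \<open>n = f x\<close> the words \<open>w\<close> with \<open>n \<in> P w\<close> form a tree of clopen pieces of the compact fibre
  over \<open>n\<close> that splits above every node.  The point \<open>\<theta> b x\<close> is found by descending this tree,
  choosing sides according to \<open>b\<close> and then the code of \<open>x\<close>.\<close>

lemma fibre_doubling:
  fixes f :: "'a::metric_space \<Rightarrow> 'b::metric_space"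
  assumes f[measurable]: "f \<in> borel_measurable borel"
    and K: "\<And>w. compact (K \<inter> cyl V w)" and cf: "continuous_on K f"
    and V: "\<And>i. open (V i)" "topological_basis (range V)"
    and P[measurable]: "\<And>w. P w \<in> sets borel"
    and A[measurable]: "A \<in> sets borel"
    and root: "\<And>x. x \<in> A \<Longrightarrow> f x \<in> P []"
    and image: "\<And>x w. x \<in> A \<Longrightarrow> f x \<in> P w \<Longrightarrow> f x \<in> f ` (K \<inter> cyl V w)"
    and split: "\<And>x w. x \<in> A \<Longrightarrow> f x \<in> P w \<Longrightarrow> \<exists>p. splits w p \<and> f x \<in> P (fst p) \<and> f x \<in> P (snd p)"
  obtains \<theta> :: "bool \<Rightarrow> 'a \<Rightarrow> 'a"
  where "\<And>b. \<theta> b \<in> borel_measurable borel" "\<And>b x. x \<in> A \<Longrightarrow> \<theta> b x \<in> K \<and> f (\<theta> b x) = f x"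
    "\<And>b x b' x'. x \<in> A \<Longrightarrow> x' \<in> A \<Longrightarrow> \<theta> b x = \<theta> b' x' \<Longrightarrow> b = b' \<and> x = x'"
proof -
  have [measurable]: "V i \<in> sets borel" for i using V(1) by simp
  define Q where "Q n w p \<longleftrightarrow> splits w p \<and> n \<in> P (fst p) \<and> n \<in> P (snd p)" for n w p
  \<comment> \<open>Taking the least code makes the choice of a splitting pair measurable in the
    base point of the fibre.\<close>
  define sp :: "'b \<Rightarrow> bool list \<Rightarrow> bool list \<times> bool list" where
    "sp n w = from_nat (LEAST k. Q n w (from_nat k))" for n w
  have Q_sp: "Q (f x) w (sp (f x) w)" if "x \<in> A" "f x \<in> P w" for x w
    unfolding sp_def
  proof (rule LeastI_ex)
    from split[OF that] obtain p where "Q (f x) w p" unfolding Q_def ..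
    then show "\<exists>k. Q (f x) w (from_nat k)"
      by (intro exI[of _ "to_nat p"]) simp
  qed
  note sp = Q_sp[unfolded Q_def]
  define u :: "'b \<Rightarrow> (nat \<Rightarrow> bool) \<Rightarrow> nat \<Rightarrow> bool list" where
    "u n z = rec_nat [] (\<lambda>k w. if z k then snd (sp n w) else fst (sp n w))" for n z
  have u0: "u n z 0 = []" and uS: "u n z (Suc k) = (if z k then snd (sp n (u n z k)) else fst (sp n (u n z k)))" for n z k
    by (simp_all add: u_def)
  have uP: "f x \<in> P (u (f x) z k)" if "x \<in> A" for x z k
    by (induction k) (use root that sp in \<open>auto simp: u0 uS\<close>)
  have spu: "splits (u (f x) z k) (sp (f x) (u (f x) z k))" if "x \<in> A" for x z k
    using sp[OF that uP[OF that]] by blast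
  have u_len: "k \<le> length (u (f x) z k)" if "x \<in> A" for x z k
  proof (induction k)
    case (Suc k)
    with spu[OF that, of z k] show ?case by (auto simp: uS splits_def)
  qed (simp add: u0)
  have u_dec: "cyl V (u (f x) z j) \<subseteq> cyl V (u (f x) z k)" if "x \<in> A" "k \<le> j" for x z j k
    using that(2)
  proof (induction rule: dec_induct)
    case (step m)
    have "cyl V (u (f x) z (Suc m)) \<subseteq> cyl V (u (f x) z m)"
      using spu[OF that(1), of z m] by (intro cyl_take) (auto simp: uS splits_def)
    with step show ?case by blast
  qed simp
  have ex: "\<exists>y\<in>K. f y = f x \<and> (\<forall>k. y \<in> cyl V (u (f x) z k))" if x: "x \<in> A" for x z
  proof -
    define L where "L k = {y \<in> K \<inter> cyl V (u (f x) z k). f y = f x}" for k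
    have L_closed: "closed (L k)" for k
    proof -
      have "closed (f -` {f x} \<inter> (K \<inter> cyl V (u (f x) z k)))"
        using continuous_on_subset[OF cf, of "K \<inter> cyl V (u (f x) z k)"]
        by (intro continuous_on_closed_vimage[THEN iffD1, rule_format] compact_imp_closed K) auto
      moreover have "L k = f -` {f x} \<inter> (K \<inter> cyl V (u (f x) z k))" by (auto simp: L_def)
      ultimately show ?thesis by simp
    qed
    have "(K \<inter> cyl V []) \<inter> (\<Inter>k\<in>UNIV. L k) \<noteq> {}"
    proof (rule compact_imp_fip_image[OF K L_closed])
      fix I :: "nat set" assume "finite I"
      then obtain N where N: "\<And>i. i \<in> I \<Longrightarrow> i \<le> N" by (meson finite_nat_set_iff_bounded_le)
      obtain y where "y \<in> L N" using image[OF x uP[OF x, of z N]] unfolding L_def by force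
      moreover from this have "y \<in> L i" if "i \<in> I" for i
        using u_dec[OF x N[OF that], of z] unfolding L_def by blast
      ultimately show "(K \<inter> cyl V []) \<inter> (\<Inter>k\<in>I. L k) \<noteq> {}" by (auto simp: L_def cyl_def)
    qed
    then obtain y where "\<And>k. y \<in> L k" by blast
    then show ?thesis unfolding L_def by blast
  qed
  \<comment> \<open>The first decision is \<open>b\<close>, and the later ones record which basis
    sets contain \<open>x\<close>. Equal values of \<open>\<theta>\<close> force equal words at
    every stage, because the two sides of a split have disjoint cylinders. All decisions then agree,
    and they determine \<open>b\<close> and \<open>x\<close>.\<close>
  define z where "z b x k = (case k of 0 \<Rightarrow> b | Suc i \<Rightarrow> x \<in> V i)" for b x k
  define \<theta> where "\<theta> b x = (if x \<in> A then SOME y. y \<in> K \<and> f y = f x \<and> (\<forall>k. y \<in> cyl V (u (f x) (z b x) k)) else undefined)" for b x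
  have \<theta>: "\<theta> b x \<in> K \<and> f (\<theta> b x) = f x \<and> (\<forall>k. \<theta> b x \<in> cyl V (u (f x) (z b x) k))" if "x \<in> A" for b x
    using someI_ex[OF ex[OF that, unfolded Bex_def], of "z b x"] that by (simp add: \<theta>_def)
  show thesis
  proof (rule that)
    fix b
    have sp_meas: "(\<lambda>x. sp (f x) w) \<in> borel \<rightarrow>\<^sub>M count_space UNIV" for w
    proof -
      have "(\<lambda>x. LEAST k. Q (f x) w (from_nat k)) \<in> borel \<rightarrow>\<^sub>M count_space UNIV"
        unfolding Q_def by measurable
      then show ?thesis unfolding sp_def by (rule measurable_compose) simp
    qed
    have u_meas: "(\<lambda>x. u (f x) (z b x) k) \<in> borel \<rightarrow>\<^sub>M count_space UNIV" for k
    proof (induction k)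
      case (Suc k)
      have z_meas: "Measurable.pred borel (\<lambda>x. z b x k)" by (cases k) (auto simp: z_def)
      have "(\<lambda>x. if z b x k then snd (sp (f x) w) else fst (sp (f x) w)) \<in> borel \<rightarrow>\<^sub>M count_space UNIV" for w
        by (intro measurable_If z_meas[unfolded pred_def] measurable_compose[OF sp_meas]) auto
      from measurable_compose_countable[OF this Suc] show ?case unfolding uS .
    qed (simp add: u0)
    \<comment> \<open>Membership of the chosen point in \<open>V i\<close> is dictated by letter
      \<open>i\<close> of the word at stage \<open>Suc i\<close>, which has more than
      \<open>i\<close> letters. Measurability thus does not depend on how \<open>SOME\<close>
      chooses.\<close>
    have pre: "\<theta> b -` V i \<in> sets borel" for i
    proof -
      have "\<theta> b x \<in> V i \<longleftrightarrow> u (f x) (z b x) (Suc i) ! i" if "x \<in> A" for x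
      proof -
        have "\<theta> b x \<in> cyl V (u (f x) (z b x) (Suc i))" using \<theta>[OF that] by blast
        then show ?thesis using u_len[OF that, of "Suc i" "z b x"] unfolding cyl_def by auto
      qed
      then have "\<theta> b -` V i = {x \<in> space borel. if x \<in> A then u (f x) (z b x) (Suc i) ! i else undefined \<in> V i}"
        by (auto simp: \<theta>_def)
      also have "\<dots> \<in> sets borel"
      proof -
        have "Measurable.pred borel (\<lambda>x. u (f x) (z b x) (Suc i) ! i)"
          using measurable_compose[OF u_meas[of "Suc i"], of "\<lambda>w. w ! i" "count_space UNIV"] by simp
        then show ?thesis by measurable
      qed
      finally show ?thesis .
    qed
    have "countable (range V)" by simp
    then have bV: "(borel :: 'a measure) = sigma UNIV (range V)"
      by (rule borel_eq_countable_basis[OF _ V(2)])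
    show "\<theta> b \<in> borel_measurable borel"
      by (subst bV) (rule measurable_measure_of, use pre in auto)
  next
    fix b x assume "x \<in> A" then show "\<theta> b x \<in> K \<and> f (\<theta> b x) = f x" using \<theta> by blast
  next
    fix b x b' x' assume x: "x \<in> A" "x' \<in> A" and eq: "\<theta> b x = \<theta> b' x'"
    define n where "n = f x"
    have n': "f x' = n" using \<theta>[OF x(1), of b] \<theta>[OF x(2), of b'] eq unfolding n_def by metis
    have step: "z b x k = z b' x' k" if "u n (z b x) k = u n (z b' x') k" for k
    proof (rule ccontr)
      assume ne: "z b x k \<noteq> z b' x' k"
      define p where "p = sp n (u n (z b x) k)"
      have p: "splits (u n (z b x) k) p" using spu[OF x(1)] unfolding p_def n_def by blast
      have "\<theta> b x \<in> cyl V (fst p) \<and> \<theta> b x \<in> cyl V (snd p)"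
        using ne \<theta>[OF x(1), of b] \<theta>[OF x(2), of b'] eq that n' unfolding p_def
        by (metis (full_types) n_def uS)
      with p show False using cyl_unique[of "\<theta> b x" V "fst p" "snd p"] unfolding splits_def by blast
    qed
    have "u n (z b x) k = u n (z b' x') k" for k
      by (induction k) (simp_all add: u0 uS step)
    then have zz: "z b x k = z b' x' k" for k using step by blast
    have "b = b'" using zz[of 0] by (simp add: z_def)
    moreover have "x = x'"
    proof (rule ccontr)
      assume "x \<noteq> x'"
      then obtain U where "open U" "x \<in> U" "x' \<notin> U" using separation_t1 by blast
      then obtain i where "x \<in> V i" "x' \<notin> V i" using topological_basisE[OF V(2)] by (metis rangeE subsetD)
      then show False using zz[of "Suc i"] by (simp add: z_def)
    qed
    ultimately show "b = b' \<and> x = x'" by simp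
  qed
qed

text \<open>A Borel subset of \<open>D\<close> on which \<open>f\<close> is injective is mapped into \<open>N\<close> without change of measure,
  so it is null.  Hence \<open>P\<close> splits almost everywhere, and \<open>fibre_doubling\<close> applies.\<close>

theorem pmp_graph_avoids_null:
  fixes M :: "'a::polish_space measure"
  assumes M: "finite_measure M" "sets M = sets borel" and pmp: "pmp_graph M E" and G: "simple_graph E"
    and D: "D \<in> sets borel" and f[measurable]: "f \<in> borel_measurable borel"
    and Ef: "\<And>x. x \<in> D \<Longrightarrow> E x (f x)" and N: "N \<in> null_sets M"
  shows "AE x in M. x \<in> D \<longrightarrow> f x \<notin> N"
proof -
  interpret finite_measure M by fact
  have sp[simp]: "space M = UNIV" using sets_eq_imp_space_eq[OF M(2)] by simp
  note [measurable_cong] = M(2)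
  have N_meas: "N \<in> sets borel" using N M(2) by auto
  define Q where "Q = D \<inter> f -` N"
  have Q: "Q \<in> sets borel"
    unfolding Q_def by (intro sets.Int D measurable_sets_borel[OF f] N_meas)
  \<comment> \<open>Two points of one fibre are joined by a path of length two through their common
    value, so fibre-preserving maps stay inside the connectedness relation.\<close>
  have conn: "E\<^sup>*\<^sup>* x y" if "x \<in> Q" "y \<in> Q" "f x = f y" for x y
  proof -
    have "E x (f x)" "E (f y) y"
      using that Ef G unfolding Q_def simple_graph_def by blast+
    then have "E x (f x)" "E (f x) y" using that(3) by simp_all
    then show ?thesis by (meson r_into_rtranclp rtranclp_trans)
  qed
  have transversal: "AE x in M. x \<notin> Z" if Z: "Z \<in> sets borel" "Z \<subseteq> Q" "inj_on f Z" for Z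
  proof -
    have "measure M Z \<le> 0"
    proof (rule field_le_epsilon)
      fix e :: real assume "e > 0"
      have "E\<^sup>*\<^sup>* x (f x)" if "x \<in> Z" for x using Ef that Z(2) by (auto simp: Q_def)
      then obtain K where K: "K \<subseteq> Z" "K \<in> sets borel" "measure M (Z - K) < e"
        "f ` K \<in> sets borel" "measure M (f ` K) = measure M K"
        using pmp_graph_image[OF M pmp Z(1) f Z(3) _ \<open>e > 0\<close>] by blast
      have "f ` K \<subseteq> N" using K(1) Z(2) by (auto simp: Q_def)
      then have "measure M K = 0"
        using K(4,5) N null_sets_subset[OF N, of "f ` K"] M(2) by (simp add: measure_eq_0_null_sets)
      moreover have "measure M (Z - K) = measure M Z - measure M K"
        using K Z M(2) by (intro finite_measure_Diff) auto
      ultimately show "measure M Z \<le> 0 + e" using K(3) by simp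
    qed
    then have "Z \<in> null_sets M"
      using Z(1) M(2) measure_nonneg[of M Z] by (simp add: null_sets_def emeasure_eq_measure)
    then show ?thesis by (rule AE_not_in)
  qed
  have "measure M Q = 0"
  proof (rule ccontr)
    assume "measure M Q \<noteq> 0"
    then have "measure M Q > 0" using measure_nonneg[of M Q] by linarith
    obtain B :: "'a set set" where B: "countable B" "topological_basis B" using ex_countable_basis by blast
    have "B \<noteq> {}"
      using topological_basisE[OF B(2) open_UNIV UNIV_I] by blast
    define V where "V = from_nat_into B"
    have V: "range V = B" unfolding V_def using B(1) \<open>B \<noteq> {}\<close> by (rule range_from_nat_into[rotated])
    have V_open: "open (V i)" for i using topological_basis_open[OF B(2)] V by auto
    then have [measurable]: "V i \<in> sets borel" for i by simp
    \<comment> \<open>Bundling \<open>f\<close> with the indicators of all basis sets lets one use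
      of Lusin's theorem make \<open>f\<close> continuous on \<open>K\<close> and every
      \<open>V i\<close> clopen relative to \<open>K\<close>. This is why the pieces
      \<open>K \<inter> cyl V w\<close> are compact.\<close>
    define g where "g x = (f x, \<lambda>i. indicator (V i) x :: real)" for x
    have g: "g \<in> borel_measurable borel"
      unfolding g_def by (intro borel_measurable_Pair f measurable_coordinatewise_then_product) measurable
    obtain K where K: "compact K" "K \<subseteq> Q" "continuous_on K g" "measure M (Q - K) < measure M Q"
      by (rule lusin[OF M Q g \<open>measure M Q > 0\<close>])
    have K_meas[measurable]: "K \<in> sets borel" using K(1) by (simp add: borel_closed compact_imp_closed)
    have K_pos: "measure M K > 0"
      using finite_measure_Diff[of Q K] Q K M(2) by simp
    have cf: "continuous_on K f"
      using continuous_on_fst[OF K(3)] by (simp add: g_def)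
    have cV: "continuous_on K (indicator (V i) :: 'a \<Rightarrow> real)" for i
      using continuous_on_product_then_coordinatewise[OF continuous_on_snd[OF K(3)], of i] by (simp add: g_def)
    have K_cyl: "compact (K \<inter> cyl V w)" for w
    proof -
      have "closed ((\<lambda>x. indicator (V i) x :: real) -` {of_bool b} \<inter> K)" for i b
        using continuous_on_closed_vimage[OF compact_imp_closed[OF K(1)], THEN iffD1, OF cV] by auto
      then have "compact (K \<inter> (\<Inter>i\<in>{..<length w}. (\<lambda>x. indicator (V i) x :: real) -` {of_bool (w ! i)} \<inter> K))"
        using K(1) by (intro compact_Int_closed closed_INT) auto
      also have "K \<inter> (\<Inter>i\<in>{..<length w}. (\<lambda>x. indicator (V i) x :: real) -` {of_bool (w ! i)} \<inter> K) = K \<inter> cyl V w"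
        by (auto simp: cyl_def indicator_def split: if_splits)
      finally show ?thesis .
    qed
    have [measurable]: "cyl V w \<in> sets borel" for w
    proof -
      have "cyl V w = {x \<in> space borel. \<forall>i<length w. (x \<in> V i) = w ! i}" by (simp add: cyl_def)
      then show ?thesis by simp
    qed
    have fM[measurable]: "f \<in> M \<rightarrow>\<^sub>M borel" using f M(2) by (simp cong: measurable_cong_sets)
    define R where "R w P \<longleftrightarrow> P \<in> sets borel \<and> (AE x in M. x \<in> K \<inter> cyl V w \<longrightarrow> f x \<in> P) \<and>
      (\<forall>Z. Z \<in> sets borel \<longrightarrow> Z \<subseteq> P \<longrightarrow> (AE x in M. x \<in> K \<inter> cyl V w \<longrightarrow> f x \<notin> Z) \<longrightarrow>
         (AE x in M. x \<in> K \<longrightarrow> f x \<notin> Z))" for w P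
    have "\<exists>P. R w P" for w
      unfolding R_def by (rule essential_image[OF M(1) fM, of K "K \<inter> cyl V w"]) (auto simp: M(2))
    then obtain P where R: "\<And>w. R w (P w)" by metis
    have P[measurable]: "P w \<in> sets borel"
      and P_sup: "AE x in M. x \<in> K \<inter> cyl V w \<longrightarrow> f x \<in> P w" for w
      using R[of w] unfolding R_def by blast+
    have P_min: "AE x in M. x \<in> K \<longrightarrow> f x \<notin> Z"
      if "Z \<in> sets borel" "Z \<subseteq> P w" "AE x in M. x \<in> K \<inter> cyl V w \<longrightarrow> f x \<notin> Z" for w Z
      using R[of w] that unfolding R_def by blast
    have im_meas[measurable]: "f ` (K \<inter> cyl V w) \<in> sets borel" for w
      by (intro borel_closed compact_imp_closed compact_continuous_image K_cyl continuous_on_subset[OF cf]) auto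
    \<comment> \<open>A value in \<open>P w\<close> outside this image is not attained on
      \<open>K \<inter> cyl V w\<close>, so \<open>P_min\<close> makes the set of such values
      negligible on all of \<open>K\<close>.\<close>
    have image: "AE x in M. x \<in> K \<longrightarrow> f x \<in> P w \<longrightarrow> f x \<in> f ` (K \<inter> cyl V w)" for w
    proof -
      have "AE x in M. x \<in> K \<longrightarrow> f x \<notin> P w - f ` (K \<inter> cyl V w)"
        by (rule P_min[of _ w]) auto
      then show ?thesis by eventually_elim blast
    qed
    have split: "AE x in M. x \<in> K \<longrightarrow> f x \<in> P w \<longrightarrow> (\<exists>p. splits w p \<and> f x \<in> P (fst p) \<and> f x \<in> P (snd p))" for w
    proof -
      define Bad where "Bad = {n \<in> space borel. n \<in> P w \<and> \<not> (\<exists>p. splits w p \<and> n \<in> P (fst p) \<and> n \<in> P (snd p))}"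
      have [measurable]: "Bad \<in> sets borel" unfolding Bad_def by measurable
      \<comment> \<open>Two points of \<open>Z\<close> with the same value are separated by some
        \<open>V i\<close>, and their sufficiently long words would split \<open>w\<close>, contrary
        to \<open>Bad\<close>. So \<open>Z\<close> is a transversal, hence null, and
        \<open>P_min\<close> carries the conclusion from the cylinder to all of
        \<open>K\<close>.\<close>
      define Z where "Z = {x \<in> space borel. x \<in> K \<inter> cyl V w \<and> f x \<in> Bad \<and> (\<forall>v. x \<in> cyl V v \<longrightarrow> f x \<in> P v)}"
      have "Z \<in> sets borel" unfolding Z_def by measurable
      moreover have "inj_on f Z"
      proof (rule inj_onI, rule ccontr)
        fix x y assume xy: "x \<in> Z" "y \<in> Z" "f x = f y" "x \<noteq> y"
        then obtain U where "open U" "x \<in> U" "y \<notin> U" using separation_t1 by blast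
        then obtain i where i: "x \<in> V i" "y \<notin> V i"
          using topological_basisE[OF B(2)] V by (metis rangeE subsetD)
        \<comment> \<open>Words of this length contain letter \<open>i\<close> and are strictly
          longer than \<open>w\<close>.\<close>
        define m where "m = Suc (max i (length w))"
        have m: "i < m" "length w < m" by (auto simp: m_def)
        define v where "v t = map (\<lambda>j. t \<in> V j) [0..<m]" for t
        have in_cyl: "t \<in> cyl V (v t)" for t by (auto simp: cyl_def v_def)
        have "take (length w) (v t) = w" if "t \<in> Z" for t
          using that m(2) by (intro nth_equalityI) (auto simp: v_def Z_def cyl_def)
        moreover have "v x \<noteq> v y"
        proof
          assume "v x = v y"
          then have "v x ! i = v y ! i" by simp
          then show False using i m(1) by (simp add: v_def)
        qed
        ultimately have "splits w (v x, v y)" using xy(1,2) m(2) by (simp add: splits_def v_def)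
        moreover have "f x \<in> P (v x)" "f x \<in> P (v y)"
          using xy in_cyl[of x] in_cyl[of y] by (auto simp: Z_def)
        moreover have "f x \<in> Bad" using xy by (auto simp: Z_def)
        ultimately show False unfolding Bad_def by force
      qed
      ultimately have "AE x in M. x \<notin> Z" using K(2) by (intro transversal) (auto simp: Z_def)
      moreover have "AE x in M. \<forall>v. x \<in> K \<inter> cyl V v \<longrightarrow> f x \<in> P v"
        using P_sup by (subst AE_all_countable) auto
      ultimately have "AE x in M. x \<in> K \<inter> cyl V w \<longrightarrow> f x \<notin> Bad"
        by eventually_elim (auto simp: Z_def)
      then have "AE x in M. x \<in> K \<longrightarrow> f x \<notin> Bad"
        by (intro P_min[of Bad w]) (auto simp: Bad_def)
      then show ?thesis by eventually_elim (auto simp: Bad_def)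
    qed
    \<comment> \<open>Countably many almost sure properties are imposed at every point, as
      \<open>fibre_doubling\<close> requires; this costs a null subset of \<open>K\<close>.\<close>
    define A where "A = {x \<in> space borel. x \<in> K \<and> f x \<in> P [] \<and>
       (\<forall>w. f x \<in> P w \<longrightarrow> f x \<in> f ` (K \<inter> cyl V w)) \<and>
       (\<forall>w. f x \<in> P w \<longrightarrow> (\<exists>p. splits w p \<and> f x \<in> P (fst p) \<and> f x \<in> P (snd p)))}"
    have A_meas[measurable]: "A \<in> sets borel" unfolding A_def by measurable
    have "AE x in M. x \<in> K \<longleftrightarrow> x \<in> A"
    proof -
      have "AE x in M. \<forall>w. x \<in> K \<longrightarrow> f x \<in> P w \<longrightarrow> f x \<in> f ` (K \<inter> cyl V w)"
        using image by (subst AE_all_countable) auto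
      moreover have "AE x in M. \<forall>w. x \<in> K \<longrightarrow> f x \<in> P w \<longrightarrow> (\<exists>p. splits w p \<and> f x \<in> P (fst p) \<and> f x \<in> P (snd p))"
        using split by (subst AE_all_countable) auto
      moreover have "AE x in M. x \<in> K \<inter> cyl V [] \<longrightarrow> f x \<in> P []" by (rule P_sup)
      ultimately show ?thesis by eventually_elim (auto simp: A_def cyl_def)
    qed
    then have A_K: "measure M A = measure M K"
      by (intro measure_eq_AE) (auto simp: M(2))
    have A_sub: "A \<subseteq> K" by (auto simp: A_def)
    obtain \<theta> :: "bool \<Rightarrow> 'a \<Rightarrow> 'a" where \<theta>: "\<And>b. \<theta> b \<in> borel_measurable borel"
      and \<theta>_fib: "\<And>b x. x \<in> A \<Longrightarrow> \<theta> b x \<in> K \<and> f (\<theta> b x) = f x"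
      and \<theta>_inj: "\<And>b x b' x'. x \<in> A \<Longrightarrow> x' \<in> A \<Longrightarrow> \<theta> b x = \<theta> b' x' \<Longrightarrow> b = b' \<and> x = x'"
    proof -
      have "topological_basis (range V)" using B V by simp
      moreover have "f x \<in> P []" "\<And>w. f x \<in> P w \<Longrightarrow> f x \<in> f ` (K \<inter> cyl V w)"
        "\<And>w. f x \<in> P w \<Longrightarrow> \<exists>p. splits w p \<and> f x \<in> P (fst p) \<and> f x \<in> P (snd p)" if "x \<in> A" for x
        using that unfolding A_def by blast+
      ultimately show thesis using that by (rule fibre_doubling[OF f K_cyl cf V_open _ P A_meas])
    qed
    \<comment> \<open>With a loss below \<open>measure M K / 2\<close>, each \<open>L b\<close>
      keeps more than half of the measure of \<open>K\<close>, so two disjoint images of this size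
      cannot both fit into \<open>K\<close>.\<close>
    have "\<exists>L. L \<subseteq> A \<and> L \<in> sets borel \<and> measure M (A - L) < measure M K / 2 \<and>
       \<theta> b ` L \<in> sets borel \<and> measure M (\<theta> b ` L) = measure M L" for b
    proof -
      have "E\<^sup>*\<^sup>* x (\<theta> b x)" if "x \<in> A" for x
        using conn[of x "\<theta> b x"] \<theta>_fib[OF that, of b] that A_sub K(2) by auto
      moreover have "inj_on (\<theta> b) A" using \<theta>_inj by (auto intro: inj_onI)
      ultimately show ?thesis
        using pmp_graph_image[OF M pmp A_meas \<theta>, of b "measure M K / 2"] K_pos by (metis half_gt_zero)
    qed
    then obtain L where L: "\<And>b. L b \<subseteq> A" "\<And>b. L b \<in> sets borel" "\<And>b. measure M (A - L b) < measure M K / 2"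
      "\<And>b. \<theta> b ` L b \<in> sets borel" "\<And>b. measure M (\<theta> b ` L b) = measure M (L b)" by metis
    have "measure M (L b) > measure M K / 2" for b
      using finite_measure_Diff[of A "L b"] L[of b] A_meas M(2) A_K by simp
    then have "measure M K < measure M (\<theta> False ` L False) + measure M (\<theta> True ` L True)"
      unfolding L(5) using add_strict_mono[of "measure M K / 2" _ "measure M K / 2"] by (smt (verit) field_sum_of_halves)
    also have "\<dots> = measure M (\<theta> False ` L False \<union> \<theta> True ` L True)"
      using \<theta>_inj L(1) L(4) M(2) by (intro finite_measure_Union[symmetric]) (auto, blast)
    also have "\<dots> \<le> measure M K"
    proof (rule finite_measure_mono)
      show "\<theta> False ` L False \<union> \<theta> True ` L True \<subseteq> K" using \<theta>_fib L(1) by blast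
    qed (simp add: M(2))
    finally show False by simp
  qed
  then have "Q \<in> null_sets M" using Q M(2) by (simp add: null_sets_def emeasure_eq_measure)
  from AE_not_in[OF this] show ?thesis by eventually_elim (auto simp: Q_def)
qed

section \<open>Square-integrable functions and sums of partial isomorphisms\<close>

lemma L2_measurable[measurable_dest]: "f \<in> L2 M \<Longrightarrow> f \<in> borel_measurable M"
  by (simp add: L2_def)

lemma borel_measurable_cnj [measurable (raw)]:
  "f \<in> borel_measurable M \<Longrightarrow> (\<lambda>x. cnj (f x)) \<in> borel_measurable M"
  by (rule borel_measurable_continuous_on[of cnj]) (intro continuous_intros)

lemma L2_integrable: "f \<in> L2 M \<Longrightarrow> integrable M (\<lambda>x. (cmod (f x))\<^sup>2)"
  by (simp add: L2_def)

lemma cmod_add_sq_le: "(cmod (a + b))\<^sup>2 \<le> 2 * (cmod a)\<^sup>2 + 2 * (cmod b)\<^sup>2"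
proof -
  have "(cmod (a + b))\<^sup>2 \<le> (cmod a + cmod b)\<^sup>2"
    by (intro power_mono norm_triangle_ineq) simp
  also have "\<dots> \<le> 2 * (cmod a)\<^sup>2 + 2 * (cmod b)\<^sup>2"
    using zero_le_power2[of "cmod a - cmod b"] by (simp add: power2_sum power2_diff)
  finally show ?thesis .
qed

lemma L2_dominated:
  assumes "f \<in> borel_measurable M" "integrable M F" "\<And>x. x \<in> space M \<Longrightarrow> (cmod (f x))\<^sup>2 \<le> F x"
  shows "f \<in> L2 M" "L2_normsq M f \<le> (\<integral>x. F x \<partial>M)"
proof -
  note [measurable] = assms(1)
  have "integrable M (\<lambda>x. (cmod (f x))\<^sup>2)"
    by (rule Bochner_Integration.integrable_bound[OF assms(2)]) (auto intro!: AE_I2 order_trans[OF assms(3)])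
  then show "f \<in> L2 M" "L2_normsq M f \<le> (\<integral>x. F x \<partial>M)"
    using assms by (auto simp: L2_def L2_normsq_def intro!: integral_mono)
qed

lemma L2_scale: "f \<in> L2 M \<Longrightarrow> (\<lambda>x. c * f x) \<in> L2 M"
  by (auto simp: L2_def norm_mult power_mult_distrib)

lemma L2_normsq_scale: "L2_normsq M (\<lambda>x. c * f x) = (cmod c)\<^sup>2 * L2_normsq M f"
  by (simp add: L2_normsq_def norm_mult power_mult_distrib)

lemma L2_cnj: "f \<in> L2 M \<Longrightarrow> (\<lambda>x. cnj (f x)) \<in> L2 M"
  by (auto simp: L2_def)

lemma L2_normsq_cnj: "L2_normsq M (\<lambda>x. cnj (f x)) = L2_normsq M f"
  by (simp add: L2_normsq_def)

lemma L2_normsq_nonneg: "0 \<le> L2_normsq M f"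
  by (simp add: L2_normsq_def)

lemma L2_diff:
  assumes "f \<in> L2 M" "g \<in> L2 M"
  shows "(\<lambda>x. f x - g x) \<in> L2 M"
    "L2_normsq M (\<lambda>x. f x - g x) \<le> 2 * L2_normsq M f + 2 * L2_normsq M g"
proof -
  have *: "(cmod (f x - g x))\<^sup>2 \<le> 2 * (cmod (f x))\<^sup>2 + 2 * (cmod (g x))\<^sup>2" for x
    using cmod_add_sq_le[of "f x" "- g x"] by simp
  have m: "(\<lambda>x. f x - g x) \<in> borel_measurable M"
    using assms by measurable
  have i: "integrable M (\<lambda>x. 2 * (cmod (f x))\<^sup>2 + 2 * (cmod (g x))\<^sup>2)"
    using assms by (auto simp: L2_integrable)
  show "(\<lambda>x. f x - g x) \<in> L2 M" by (rule L2_dominated[OF m i *])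
  have "L2_normsq M (\<lambda>x. f x - g x) \<le> (\<integral>x. 2 * (cmod (f x))\<^sup>2 + 2 * (cmod (g x))\<^sup>2 \<partial>M)"
    by (rule L2_dominated[OF m i *])
  also have "\<dots> = 2 * L2_normsq M f + 2 * L2_normsq M g"
    using assms by (simp add: L2_normsq_def L2_integrable)
  finally show "L2_normsq M (\<lambda>x. f x - g x) \<le> 2 * L2_normsq M f + 2 * L2_normsq M g" .
qed

lemma L2_normsq_cong_AE:
  assumes "f \<in> borel_measurable M" "g \<in> borel_measurable M" "AE x in M. f x = g x"
  shows "L2_normsq M f = L2_normsq M g"
  unfolding L2_normsq_def using assms by (intro integral_cong_AE) auto

lemma L2_normsq_eq_0_iff:
  assumes "f \<in> L2 M"
  shows "L2_normsq M f = 0 \<longleftrightarrow> (AE x in M. f x = 0)"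
  unfolding L2_normsq_def using assms by (subst integral_nonneg_eq_0_iff_AE) (auto simp: L2_integrable)

definition L2_inner :: "'a measure \<Rightarrow> ('a \<Rightarrow> complex) \<Rightarrow> ('a \<Rightarrow> complex) \<Rightarrow> complex" where
  "L2_inner M f g = (\<integral>x. f x * cnj (g x) \<partial>M)"

lemma L2_mult_integrable:
  assumes "f \<in> L2 M" "g \<in> L2 M"
  shows "integrable M (\<lambda>x. f x * cnj (g x))"
proof (rule Bochner_Integration.integrable_bound)
  show "integrable M (\<lambda>x. (cmod (f x))\<^sup>2 + (cmod (g x))\<^sup>2)" using assms by (auto simp: L2_integrable)
  show "(\<lambda>x. f x * cnj (g x)) \<in> borel_measurable M" using assms by measurable
  have "cmod a * cmod b \<le> (cmod a)\<^sup>2 + (cmod b)\<^sup>2" for a b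
    using zero_le_power2[of "cmod a - cmod b"] mult_nonneg_nonneg[of "cmod a" "cmod b"]
    by (simp add: power2_diff del: mult_nonneg_nonneg)
  then show "AE x in M. norm (f x * cnj (g x)) \<le> norm ((cmod (f x))\<^sup>2 + (cmod (g x))\<^sup>2)"
    by (simp add: norm_mult)
qed

lemma L2_inner_self: "L2_inner M f f = of_real (L2_normsq M f)"
  by (simp add: L2_inner_def L2_normsq_def complex_norm_square[symmetric] flip: of_real_power)

lemma L2_inner_cong_AE:
  assumes "f \<in> borel_measurable M" "g \<in> borel_measurable M"
    "f' \<in> borel_measurable M" "g' \<in> borel_measurable M"
    "AE x in M. f x = f' x" "AE x in M. g x = g' x"
  shows "L2_inner M f g = L2_inner M f' g'"
  unfolding L2_inner_def using assms by (intro integral_cong_AE) (auto elim: AE_mp)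

lemma L2_normsq_diff:
  assumes "f \<in> L2 M" "g \<in> L2 M"
  shows "L2_normsq M (\<lambda>x. f x - g x) = L2_normsq M f - 2 * Re (L2_inner M f g) + L2_normsq M g"
proof -
  define p where "p x = f x * cnj (g x)" for x
  have p: "integrable M p" unfolding p_def by (rule L2_mult_integrable[OF assms])
  have "(cmod (f x - g x))\<^sup>2 = (cmod (f x))\<^sup>2 - 2 * Re (p x) + (cmod (g x))\<^sup>2" for x
    unfolding p_def by (simp add: cmod_power2 power2_diff algebra_simps)
  then have "L2_normsq M (\<lambda>x. f x - g x) = (\<integral>x. (cmod (f x))\<^sup>2 - 2 * Re (p x) + (cmod (g x))\<^sup>2 \<partial>M)"
    by (simp add: L2_normsq_def)
  also have "\<dots> = L2_normsq M f - 2 * (\<integral>x. Re (p x) \<partial>M) + L2_normsq M g"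
    using assms p by (simp add: L2_normsq_def L2_integrable)
  also have "(\<integral>x. Re (p x) \<partial>M) = Re (L2_inner M f g)"
    unfolding L2_inner_def p_def[symmetric] using p by (rule integral_Re)
  finally show ?thesis .
qed

text \<open>The total map \<open>\<theta> k\<close> stands for its restriction to
  \<open>A k\<close>; the axioms for \<open>k\<close> and \<open>inv k\<close> together make this a
  measure-preserving bijection onto \<open>A (inv k)\<close>. The involution closes the family under
  inverses, which is what makes the operator \<open>T\<close> below self-adjoint.\<close>

locale partial_isos = finite_measure M for M :: "'a measure" +
  fixes I :: "'k set" and A :: "'k \<Rightarrow> 'a set" and \<theta> :: "'k \<Rightarrow> 'a \<Rightarrow> 'a" and inv :: "'k \<Rightarrow> 'k"
  assumes finite_I: "finite I"
    and A[measurable]: "A k \<in> sets M" and \<theta>[measurable]: "\<theta> k \<in> M \<rightarrow>\<^sub>M M"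
    and inv: "k \<in> I \<Longrightarrow> inv k \<in> I" "inv (inv k) = k"
    and \<theta>_inv: "k \<in> I \<Longrightarrow> x \<in> A k \<Longrightarrow> \<theta> k x \<in> A (inv k) \<and> \<theta> (inv k) (\<theta> k x) = x"
    and preserves: "k \<in> I \<Longrightarrow> C \<in> sets M \<Longrightarrow> C \<subseteq> A (inv k) \<Longrightarrow> emeasure M (\<theta> k -` C \<inter> A k) = emeasure M C"
begin

lemma distr_restricted:
  assumes k: "k \<in> I"
  shows "distr (density M (indicator (A k))) M (\<theta> k) = density M (indicator (A (inv k)))"
proof (rule measure_eqI)
  fix C assume "C \<in> sets (distr (density M (indicator (A k))) M (\<theta> k))"
  then have C[measurable]: "C \<in> sets M" by simp
  have Asp: "A k \<subseteq> space M" using sets.sets_into_space[OF A] .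
  have "emeasure (distr (density M (indicator (A k))) M (\<theta> k)) C
      = emeasure (density M (indicator (A k))) (\<theta> k -` C \<inter> space M)"
    by (subst emeasure_distr) auto
  also have "\<dots> = emeasure M (A k \<inter> (\<theta> k -` C \<inter> space M))"
    by (subst emeasure_density) (auto simp: emeasure_restricted nn_integral_indicator[symmetric] indicator_inter_arith simp del: nn_integral_indicator)
  also have "A k \<inter> (\<theta> k -` C \<inter> space M) = \<theta> k -` (C \<inter> A (inv k)) \<inter> A k"
    using \<theta>_inv[OF k] Asp by auto
  also have "emeasure M \<dots> = emeasure M (A (inv k) \<inter> C)"
    by (subst preserves[OF k]) (auto simp: Int_commute)
  also have "\<dots> = emeasure (density M (indicator (A (inv k)))) C"
    by (subst emeasure_density) (auto simp: nn_integral_indicator[symmetric] indicator_inter_arith simp del: nn_integral_indicator)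
  finally show "emeasure (distr (density M (indicator (A k))) M (\<theta> k)) C
      = emeasure (density M (indicator (A (inv k)))) C" .
qed simp

lemma density_indicator_eq: "density M (indicator S) = density M (\<lambda>x. ennreal (indicat_real S x))"
  by (simp add: ennreal_indicator)

lemmas distr_restricted' = distr_restricted[unfolded density_indicator_eq]

lemma integrable_transfer:
  fixes g :: "'a \<Rightarrow> 'b::{banach, second_countable_topology}"
  assumes k: "k \<in> I" and [measurable]: "g \<in> borel_measurable M"
  shows "integrable M (\<lambda>x. indicat_real (A k) x *\<^sub>R g (\<theta> k x)) \<longleftrightarrow> integrable M (\<lambda>x. indicat_real (A (inv k)) x *\<^sub>R g x)"
proof -
  have "integrable M (\<lambda>x. indicat_real (A k) x *\<^sub>R g (\<theta> k x)) \<longleftrightarrow>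
     integrable (density M (indicator (A k))) (\<lambda>x. g (\<theta> k x))"
    unfolding density_indicator_eq by (subst integrable_density) auto
  also have "\<dots> \<longleftrightarrow> integrable (distr (density M (indicator (A k))) M (\<theta> k)) g"
    by (subst integrable_distr_eq) auto
  also have "\<dots> \<longleftrightarrow> integrable M (\<lambda>x. indicat_real (A (inv k)) x *\<^sub>R g x)"
    unfolding density_indicator_eq distr_restricted'[OF k] by (subst integrable_density) auto
  finally show ?thesis .
qed

lemma integral_transfer:
  fixes g :: "'a \<Rightarrow> 'b::{banach, second_countable_topology}"
  assumes k: "k \<in> I" and [measurable]: "g \<in> borel_measurable M"
  shows "(\<integral>x. indicat_real (A k) x *\<^sub>R g (\<theta> k x) \<partial>M) = (\<integral>x. indicat_real (A (inv k)) x *\<^sub>R g x \<partial>M)"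
proof -
  have "(\<integral>x. indicat_real (A k) x *\<^sub>R g (\<theta> k x) \<partial>M) = (\<integral>x. g (\<theta> k x) \<partial>density M (indicator (A k)))"
    unfolding density_indicator_eq by (subst integral_density) auto
  also have "\<dots> = (\<integral>x. g x \<partial>distr (density M (indicator (A k))) M (\<theta> k))"
    by (subst integral_distr) auto
  also have "\<dots> = (\<integral>x. indicat_real (A (inv k)) x *\<^sub>R g x \<partial>M)"
    unfolding density_indicator_eq distr_restricted'[OF k] by (subst integral_density) auto
  finally show ?thesis .
qed

lemma AE_transfer:
  assumes k: "k \<in> I" and P: "AE x in M. P x"
  shows "AE x in M. x \<in> A k \<longrightarrow> P (\<theta> k x)"
proof -
  obtain N where N: "{x \<in> space M. \<not> P x} \<subseteq> N" "N \<in> null_sets M"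
    using P unfolding eventually_ae_filter by blast
  define Z where "Z = \<theta> k -` (N \<inter> A (inv k)) \<inter> A k"
  have "N \<inter> A (inv k) \<in> null_sets M" using N(2) A by (rule null_set_Int2)
  then have NA: "N \<inter> A (inv k) \<in> sets M" "emeasure M (N \<inter> A (inv k)) = 0" by (rule null_setsD2, rule null_setsD1)
  have "Z = (\<theta> k -` (N \<inter> A (inv k)) \<inter> space M) \<inter> A k"
    unfolding Z_def using sets.sets_into_space[OF A] by blast
  then have "Z \<in> sets M" using measurable_sets[OF \<theta> NA(1)] A by simp
  moreover have "emeasure M Z = 0"
    unfolding Z_def using preserves[OF k NA(1)] NA(2) by simp
  ultimately have "Z \<in> null_sets M" by (simp add: null_setsI)
  from AE_not_in[OF this] AE_space show ?thesis
  proof eventually_elim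
    case (elim x)
    have "P (\<theta> k x)" if "x \<in> A k"
    proof -
      have "\<theta> k x \<notin> N" using elim(1) \<theta>_inv[OF k that] that unfolding Z_def by blast
      moreover have "\<theta> k x \<in> space M" by (rule measurable_space[OF \<theta> elim(2)])
      ultimately show ?thesis using N(1) by blast
    qed
    then show ?case by blast
  qed
qed

definition T :: "('a \<Rightarrow> complex) \<Rightarrow> 'a \<Rightarrow> complex" where
  "T f x = (\<Sum>k\<in>I. indicat_real (A k) x *\<^sub>R f (\<theta> k x))"

text \<open>This is the Cauchy-Schwarz majorant of the squared modulus of \<open>T f\<close>. It is
  monotone in the modulus of \<open>f\<close>, so it also serves for every function dominated by
  \<open>f\<close>.\<close>

definition energy :: "('a \<Rightarrow> complex) \<Rightarrow> 'a \<Rightarrow> real" where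
  "energy f x = card I * (\<Sum>k\<in>I. indicat_real (A k) x *\<^sub>R (cmod (f (\<theta> k x)))\<^sup>2)"

lemma T_measurable[measurable]:
  assumes [measurable]: "f \<in> borel_measurable M" shows "T f \<in> borel_measurable M"
  unfolding T_def by measurable

lemma cmod_T_le: "(cmod (T f x))\<^sup>2 \<le> energy f x"
proof -
  have "(cmod (T f x))\<^sup>2 \<le> (\<Sum>k\<in>I. indicat_real (A k) x * cmod (f (\<theta> k x)))\<^sup>2"
    unfolding T_def by (intro power_mono order_trans[OF norm_sum] sum_mono) auto
  also have "\<dots> \<le> (\<Sum>k\<in>I. (indicat_real (A k) x * cmod (f (\<theta> k x)))\<^sup>2) * card I"
    by (rule sum_squared_le_sum_of_squares)
  also have "\<dots> = energy f x"
    unfolding energy_def by (simp add: mult.commute indicator_def power_mult_distrib cong: sum.cong)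
      (intro disjI2 sum.cong refl, auto)
  finally show ?thesis .
qed

lemma energy_integrable:
  assumes f: "f \<in> L2 M"
  shows "integrable M (energy f)" "(\<integral>x. energy f x \<partial>M) \<le> (real (card I))\<^sup>2 * L2_normsq M f"
proof -
  note [measurable] = f
  have bd: "integrable M (\<lambda>x. indicat_real (A k) x *\<^sub>R (cmod (f x))\<^sup>2)" for k
    using integrable_mult_indicator[OF A L2_integrable[OF f]] .
  have int: "integrable M (\<lambda>x. indicat_real (A k) x *\<^sub>R (cmod (f (\<theta> k x)))\<^sup>2)" if "k \<in> I" for k
    using bd by (subst integrable_transfer[OF that, of "\<lambda>x. (cmod (f x))\<^sup>2"]) auto
  then show "integrable M (energy f)"
    unfolding energy_def by (intro integrable_mult_right integrable_sum) auto
  have "(\<integral>x. energy f x \<partial>M) = card I * (\<Sum>k\<in>I. \<integral>x. indicat_real (A k) x *\<^sub>R (cmod (f (\<theta> k x)))\<^sup>2 \<partial>M)"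
    unfolding energy_def using int by simp
  also have "(\<Sum>k\<in>I. \<integral>x. indicat_real (A k) x *\<^sub>R (cmod (f (\<theta> k x)))\<^sup>2 \<partial>M) \<le> (\<Sum>k\<in>I. L2_normsq M f)"
  proof (rule sum_mono)
    fix k assume k: "k \<in> I"
    have "(\<integral>x. indicat_real (A k) x *\<^sub>R (cmod (f (\<theta> k x)))\<^sup>2 \<partial>M) = (\<integral>x. indicat_real (A (inv k)) x *\<^sub>R (cmod (f x))\<^sup>2 \<partial>M)"
      by (rule integral_transfer[OF k, of "\<lambda>x. (cmod (f x))\<^sup>2"]) measurable
    also have "\<dots> \<le> L2_normsq M f"
      unfolding L2_normsq_def by (intro integral_mono bd L2_integrable[OF f]) (auto simp: indicator_def)
    finally show "(\<integral>x. indicat_real (A k) x *\<^sub>R (cmod (f (\<theta> k x)))\<^sup>2 \<partial>M) \<le> L2_normsq M f" .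
  qed
  finally show "(\<integral>x. energy f x \<partial>M) \<le> (real (card I))\<^sup>2 * L2_normsq M f"
    by (simp add: power2_eq_square mult_left_mono)
qed

lemma T_L2:
  assumes f: "f \<in> L2 M"
  shows "T f \<in> L2 M" "L2_normsq M (T f) \<le> (real (card I))\<^sup>2 * L2_normsq M f"
proof -
  note [measurable] = f
  have m: "T f \<in> borel_measurable M" by measurable
  show "T f \<in> L2 M" by (rule L2_dominated[OF m energy_integrable(1)[OF f] cmod_T_le])
  show "L2_normsq M (T f) \<le> (real (card I))\<^sup>2 * L2_normsq M f"
    using L2_dominated(2)[OF m energy_integrable(1)[OF f] cmod_T_le] energy_integrable(2)[OF f] by simp
qed

text \<open>A change of variables along \<open>\<theta> k\<close> moves the term of \<open>k\<close>
  to the other side as the term of \<open>inv k\<close>, and \<open>inv\<close> permutes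
  \<open>I\<close>.\<close>

lemma T_adjoint:
  assumes f: "f \<in> L2 M" and g: "g \<in> L2 M"
  shows "L2_inner M (T f) g = L2_inner M f (T g)"
proof -
  note [measurable] = L2_measurable[OF f] L2_measurable[OF g]
  define p where "p k x = f x * cnj (g (\<theta> (inv k) x))" for k x
  have pm[measurable]: "p k \<in> borel_measurable M" for k unfolding p_def by measurable
  have 1: "indicat_real (A k) x *\<^sub>R f (\<theta> k x) * cnj (g x) = indicat_real (A k) x *\<^sub>R p k (\<theta> k x)" if "k \<in> I" for k x
    using \<theta>_inv[OF that] by (cases "x \<in> A k") (auto simp: p_def)
  have 2: "indicat_real (A (inv k)) x *\<^sub>R p k x = f x * cnj (indicat_real (A (inv k)) x *\<^sub>R g (\<theta> (inv k) x))" for k x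
    by (simp add: p_def)
  have int: "integrable M (\<lambda>x. f x * cnj (indicat_real (A k) x *\<^sub>R g (\<theta> k x)))" if "k \<in> I" for k
  proof (rule L2_mult_integrable[OF f])
    have "integrable M (\<lambda>x. indicat_real (A k) x *\<^sub>R (cmod (g (\<theta> k x)))\<^sup>2)"
      using integrable_mult_indicator[OF A L2_integrable[OF g]]
      by (subst integrable_transfer[OF that, of "\<lambda>x. (cmod (g x))\<^sup>2"]) auto
    then show "(\<lambda>x. indicat_real (A k) x *\<^sub>R g (\<theta> k x)) \<in> L2 M"
      by (rule L2_dominated(1)[rotated]) (auto simp: indicator_def)
  qed
  have int': "integrable M (\<lambda>x. indicat_real (A k) x *\<^sub>R p k (\<theta> k x))" if "k \<in> I" for k
    unfolding integrable_transfer[OF that pm] 2 using int inv(1)[OF that] .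
  have "L2_inner M (T f) g = (\<integral>x. (\<Sum>k\<in>I. indicat_real (A k) x *\<^sub>R p k (\<theta> k x)) \<partial>M)"
    unfolding L2_inner_def T_def sum_distrib_right
    by (intro Bochner_Integration.integral_cong refl sum.cong) (rule 1)
  also have "\<dots> = (\<Sum>k\<in>I. \<integral>x. indicat_real (A k) x *\<^sub>R p k (\<theta> k x) \<partial>M)"
    by (rule Bochner_Integration.integral_sum) (rule int')
  also have "\<dots> = (\<Sum>k\<in>I. \<integral>x. f x * cnj (indicat_real (A (inv k)) x *\<^sub>R g (\<theta> (inv k) x)) \<partial>M)"
    by (intro sum.cong refl) (simp only: integral_transfer[OF _ pm] 2)
  also have "\<dots> = (\<Sum>k\<in>I. \<integral>x. f x * cnj (indicat_real (A k) x *\<^sub>R g (\<theta> k x)) \<partial>M)"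
    by (rule sum.reindex_bij_witness[of _ inv inv]) (auto simp: inv)
  also have "\<dots> = (\<integral>x. (\<Sum>k\<in>I. f x * cnj (indicat_real (A k) x *\<^sub>R g (\<theta> k x))) \<partial>M)"
    by (rule Bochner_Integration.integral_sum[symmetric]) (rule int)
  also have "\<dots> = L2_inner M f (T g)"
    unfolding L2_inner_def T_def cnj_sum sum_distrib_left ..
  finally show ?thesis .
qed

text \<open>Almost everywhere convergence passes through \<open>T\<close> because \<open>T\<close>
  is pointwise a finite sum and each \<open>\<theta> k\<close> pulls null sets back to null sets.
  The Neumann series below can thus be handled pointwise.\<close>

lemma T_sums:
  assumes "AE x in M. (\<lambda>n. h n x) sums f x"
  shows "AE x in M. (\<lambda>n. T (h n) x) sums T f x"
proof -
  have "AE x in M. \<forall>k\<in>I. x \<in> A k \<longrightarrow> (\<lambda>n. h n (\<theta> k x)) sums f (\<theta> k x)"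
    using AE_transfer[OF _ assms] finite_I by (subst AE_finite_all) auto
  then show ?thesis
    unfolding T_def by eventually_elim (intro sums_sum, auto simp: indicator_def intro!: sums_scaleR_right)
qed

definition R :: "complex \<Rightarrow> ('a \<Rightarrow> complex) \<Rightarrow> 'a \<Rightarrow> complex" where
  "R c f x = T f x - c * f x"

lemma R_diff: "R c (\<lambda>x. f x - g x) x = R c f x - R c g x"
  by (simp add: R_def T_def sum_subtractf algebra_simps)

lemma R_cnj: "R (cnj c) (\<lambda>x. cnj (f x)) x = cnj (R c f x)"
  by (simp add: R_def T_def)

lemma R_L2: "f \<in> L2 M \<Longrightarrow> R c f \<in> L2 M"
  unfolding R_def by (intro L2_diff T_L2 L2_scale)

text \<open>The summand 1 makes the constant at least 1, so that its reciprocal can serve as the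
  factor \<open>t\<close> of the Neumann series.\<close>

lemma R_bounded:
  assumes "f \<in> L2 M"
  shows "L2_normsq M (R c f) \<le> (2 * (real (card I))\<^sup>2 + 2 * (cmod c)\<^sup>2 + 1) * L2_normsq M f"
  using L2_diff(2)[OF T_L2(1)[OF assms] L2_scale[OF assms], of c] T_L2(2)[OF assms] L2_normsq_nonneg[of M f]
  unfolding R_def L2_normsq_scale by (simp add: algebra_simps)

lemma R_adjoint:
  assumes f: "f \<in> L2 M" and g: "g \<in> L2 M"
  shows "L2_inner M (R c f) g = L2_inner M f (R (cnj c) g)"
proof -
  have "L2_inner M (R c f) g = L2_inner M (T f) g - c * L2_inner M f g"
    unfolding L2_inner_def R_def left_diff_distrib mult.assoc
    using L2_mult_integrable[OF T_L2(1)[OF f] g] L2_mult_integrable[OF f g] by simp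
  moreover have "L2_inner M f (R (cnj c) g) = L2_inner M f (T g) - c * L2_inner M f g"
    unfolding L2_inner_def R_def complex_cnj_diff complex_cnj_mult complex_cnj_cnj right_diff_distrib mult.left_commute
    using L2_mult_integrable[OF f T_L2(1)[OF g]] L2_mult_integrable[OF f g] by simp
  ultimately show ?thesis using T_adjoint[OF f g] by simp
qed

lemma R_sums:
  assumes "AE x in M. (\<lambda>n. h n x) sums f x"
  shows "AE x in M. (\<lambda>n. R c (h n) x) sums R c f x"
  using T_sums[OF assms] assms unfolding R_def
  by eventually_elim (intro sums_diff sums_mult)

end

section \<open>Bounded inverses\<close>

lemma L2_inner_scale_right: "L2_inner M f (\<lambda>x. a * g x) = cnj a * L2_inner M f g"
proof -
  have "L2_inner M f (\<lambda>x. a * g x) = (\<integral>x. cnj a * (f x * cnj (g x)) \<partial>M)"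
    unfolding L2_inner_def by (intro Bochner_Integration.integral_cong) (auto simp: mult_ac)
  then show ?thesis by (simp add: L2_inner_def)
qed

text \<open>Weighted Cauchy-Schwarz with \<open>q < r < 1\<close> bounds \<open>\<bar>\<Sum>n. h n\<bar>\<^sup>2\<close> by
  \<open>(\<Sum>n. r ^ n) * (\<Sum>n. \<bar>h n\<bar>\<^sup>2 / r ^ n)\<close>.\<close>

lemma L2_summable_geometric:
  assumes h: "\<And>n. h n \<in> L2 M" and q: "0 \<le> q" "q < 1" and bound: "\<And>n. L2_normsq M (h n) \<le> q ^ n * D"
  obtains f where "f \<in> L2 M" "AE x in M. (\<lambda>n. h n x) sums f x"
proof -
  have [measurable]: "h n \<in> borel_measurable M" for n using h by (rule L2_measurable)
  \<comment> \<open>The midpoint lies strictly between \<open>q\<close> and 1, so both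
    \<open>r ^ n\<close> and \<open>(q / r) ^ n\<close> are summable.\<close>
  define r where "r = (1 + q) / 2"
  have r: "0 < r" "r < 1" "q < r" using q by (auto simp: r_def)
  define W where "W n x = (cmod (h n x))\<^sup>2 / r ^ n" for n x
  have [measurable]: "W n \<in> borel_measurable M" for n unfolding W_def by measurable
  have W_nonneg: "0 \<le> W n x" for n x using r by (simp add: W_def)
  have W_int: "integrable M (W n)" for n unfolding W_def using L2_integrable[OF h] by simp
  have W_bound: "(\<integral>x. W n x \<partial>M) \<le> (q / r) ^ n * D" for n
    using bound[of n] r by (simp add: W_def L2_normsq_def[symmetric] power_divide divide_right_mono)
  have "summable (\<lambda>n. (q / r) ^ n * D)" using q r by (intro summable_mult2 summable_geometric) auto
  then have W_sum: "summable (\<lambda>n. \<integral>x. W n x \<partial>M)"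
    by (rule summable_comparison_test'[of _ 0]) (auto intro: W_bound integral_nonneg simp: W_nonneg)
  define G where "G = {x \<in> space M. (\<Sum>n. ennreal (W n x)) \<noteq> \<infinity>}"
  have [measurable]: "G \<in> sets M" unfolding G_def by measurable
  have "(\<integral>\<^sup>+x. (\<Sum>n. ennreal (W n x)) \<partial>M) = (\<Sum>n. ennreal (\<integral>x. W n x \<partial>M))"
    by (subst nn_integral_suminf) (auto simp: nn_integral_eq_integral[OF W_int] W_nonneg)
  also have "\<dots> = ennreal (\<Sum>n. \<integral>x. W n x \<partial>M)"
    by (rule suminf_ennreal2[OF _ W_sum]) (simp add: W_nonneg)
  finally have "(\<integral>\<^sup>+x. (\<Sum>n. ennreal (W n x)) \<partial>M) \<noteq> \<infinity>" by simp
  then have "AE x in M. (\<Sum>n. ennreal (W n x)) \<noteq> \<infinity>" by (rule nn_integral_PInf_AE[rotated]) measurable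
  with AE_space have AE_G: "AE x in M. x \<in> G" by eventually_elim (simp add: G_def)
  have sumW: "summable (\<lambda>n. W n x)" if "x \<in> G" for x
    using that W_nonneg by (intro summable_suminf_not_top) (auto simp: G_def)
  have sumr: "summable (\<lambda>n. r ^ n)" using r by (simp add: summable_geometric)
  have h_le: "cmod (h n x) \<le> r ^ n + W n x" for n x
  proof (rule power2_le_imp_le)
    have "(cmod (h n x))\<^sup>2 = r ^ n * W n x" using r by (simp add: W_def)
    also have "\<dots> \<le> (r ^ n + W n x)\<^sup>2" using r W_nonneg[of n x] by (simp add: power2_sum)
    finally show "(cmod (h n x))\<^sup>2 \<le> (r ^ n + W n x)\<^sup>2" .
  qed (use r W_nonneg in simp)
  have sumh: "summable (\<lambda>n. h n x)" if "x \<in> G" for x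
    using summable_add[OF sumr sumW[OF that]] by (rule summable_comparison_test'[of _ 0]) (rule h_le)
  define f where "f x = (\<Sum>n. if x \<in> G then h n x else 0)" for x
  have f_sums: "(\<lambda>n. if x \<in> G then h n x else 0) sums f x" for x
    unfolding f_def by (rule summable_sums) (cases "x \<in> G", auto simp: sumh)
  have f_meas: "f \<in> borel_measurable M"
  proof (rule borel_measurable_LIMSEQ_metric)
    show "(\<lambda>m. \<Sum>n<m. if x \<in> G then h n x else 0) \<longlonglongrightarrow> f x" for x
      using f_sums[of x] by (simp add: sums_def)
  qed measurable
  define F where "F x = (1 / (1 - r)) * (\<Sum>n. if x \<in> G then W n x else 0)" for x
  have "integrable M (\<lambda>x. \<Sum>n. if x \<in> G then W n x else 0)"
  proof (rule integrable_suminf)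
    show int': "integrable M (\<lambda>x. if x \<in> G then W n x else 0)" for n
      by (rule Bochner_Integration.integrable_bound[OF W_int[of n]]) auto
    have "summable (\<lambda>n. norm (if x \<in> G then W n x else 0))" for x
      by (cases "x \<in> G") (auto simp: sumW W_nonneg)
    then show "AE x in M. summable (\<lambda>n. norm (if x \<in> G then W n x else 0))" by simp
    have "(\<integral>x. norm (if x \<in> G then W n x else 0) \<partial>M) \<le> (\<integral>x. W n x \<partial>M)" for n
      by (intro integral_mono integrable_norm int' W_int) (simp add: W_nonneg)
    then have "norm (\<integral>x. norm (if x \<in> G then W n x else 0) \<partial>M) \<le> (\<integral>x. W n x \<partial>M)" for n
      by (simp add: integral_nonneg)
    then show "summable (\<lambda>n. \<integral>x. norm (if x \<in> G then W n x else 0) \<partial>M)"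
      by (intro summable_comparison_test'[OF W_sum, of 0])
  qed
  then have F_int: "integrable M F" unfolding F_def by simp
  have f_le: "(cmod (f x))\<^sup>2 \<le> F x" for x
  proof (cases "x \<in> G")
    case True
    have "(\<lambda>m. (cmod (\<Sum>n<m. h n x))\<^sup>2) \<longlonglongrightarrow> (cmod (f x))\<^sup>2"
      using f_sums[of x] True by (intro tendsto_power tendsto_norm) (simp add: sums_def)
    moreover have "(cmod (\<Sum>n<m. h n x))\<^sup>2 \<le> F x" for m
    proof -
      have eq: "cmod (h n x) = sqrt (r ^ n) * sqrt (W n x)" for n
        using r by (simp add: W_def real_sqrt_divide)
      have "(cmod (\<Sum>n<m. h n x))\<^sup>2 \<le> (\<Sum>n<m. sqrt (r ^ n) * sqrt (W n x))\<^sup>2"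
        unfolding eq[symmetric] by (intro power_mono norm_sum) simp
      also have "\<dots> \<le> (\<Sum>n<m. (sqrt (r ^ n))\<^sup>2) * (\<Sum>n<m. (sqrt (W n x))\<^sup>2)"
        by (rule Cauchy_Schwarz_ineq_sum)
      also have "\<dots> = (\<Sum>n<m. r ^ n) * (\<Sum>n<m. W n x)" using r W_nonneg by simp
      also have "\<dots> \<le> (\<Sum>n. r ^ n) * (\<Sum>n. W n x)"
        using r W_nonneg sumr sumW[OF True] by (intro mult_mono sum_le_suminf) (auto intro: sum_nonneg suminf_nonneg)
      also have "\<dots> = F x" using True r by (simp add: F_def suminf_geometric)
      finally show ?thesis .
    qed
    ultimately show ?thesis by (intro LIMSEQ_le_const2) auto
  next
    case False then show ?thesis by (simp add: f_def F_def)
  qed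
  have "f \<in> L2 M" by (rule L2_dominated[OF f_meas F_int f_le])
  moreover have "AE x in M. (\<lambda>n. h n x) sums f x" using AE_G
  proof eventually_elim
    case (elim x) then show ?case using f_sums[of x] by simp
  qed
  ultimately show ?thesis by (rule that)
qed

context partial_isos
begin

text \<open>The norms are squared, so \<open>C\<close> bounds the square of the norm of an
  inverse.\<close>

definition bounded_below :: "complex \<Rightarrow> real \<Rightarrow> bool" where
  "bounded_below c C \<longleftrightarrow> (\<forall>f\<in>L2 M. L2_normsq M f \<le> C * L2_normsq M (R c f))"

text \<open>\<open>T\<close> has real coefficients and commutes with conjugation, which preserves
  the norm and exchanges \<open>R c\<close> with its adjoint.\<close>

lemma bounded_below_cnj:
  assumes "bounded_below c C" shows "bounded_below (cnj c) C"
  unfolding bounded_below_def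
proof
  fix f assume f: "f \<in> L2 M"
  have "R (cnj c) f x = cnj (R c (\<lambda>x. cnj (f x)) x)" for x
    using R_cnj[of c "\<lambda>x. cnj (f x)" x] by simp
  then have "L2_normsq M (R (cnj c) f) = L2_normsq M (\<lambda>x. cnj (R c (\<lambda>x. cnj (f x)) x))"
    by presburger
  moreover have "L2_normsq M (\<lambda>x. cnj (f x)) \<le> C * L2_normsq M (R c (\<lambda>x. cnj (f x)))"
    using assms L2_cnj[OF f] unfolding bounded_below_def by blast
  ultimately show "L2_normsq M f \<le> C * L2_normsq M (R (cnj c) f)"
    unfolding L2_normsq_cnj by simp
qed

lemma bounded_below_injective:
  assumes "bounded_below c C" "f \<in> L2 M" "AE x in M. R c f x = 0"
  shows "AE x in M. f x = 0"
proof -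
  have "L2_normsq M (R c f) = 0" using assms by (simp add: L2_normsq_eq_0_iff R_L2)
  then have "L2_normsq M f \<le> 0" using assms unfolding bounded_below_def by force
  then show ?thesis using L2_normsq_eq_0_iff[OF assms(2)] L2_normsq_nonneg[of M f] by simp
qed

lemma bounded_below_injective':
  assumes "bounded_below c C" "f \<in> L2 M" "g \<in> L2 M" "AE x in M. R c f x = R c g x"
  shows "AE x in M. f x = g x"
proof -
  have "AE x in M. R c (\<lambda>x. f x - g x) x = 0" using assms(4) by eventually_elim (subst R_diff, simp)
  from bounded_below_injective[OF assms(1) L2_diff(1)[OF assms(2,3)] this] show ?thesis
    by eventually_elim simp
qed

text \<open>Neumann series for \<open>t R\<^sup>* R\<close>: with \<open>t = 1 / K\<close>, where \<open>K\<close> bounds the square of the norm of \<open>R\<close>, the operator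
  \<open>1 - t R\<^sup>* R\<close> is a strict contraction.\<close>

lemma bounded_below_surjective:
  assumes bb: "bounded_below c C" and g: "g \<in> L2 M"
  obtains f where "f \<in> L2 M" "AE x in M. R c f x = g x"
proof -
  define K where "K = 2 * (real (card I))\<^sup>2 + 2 * (cmod c)\<^sup>2 + 1"
  have K: "1 \<le> K" "0 < K" by (auto simp: K_def add_nonneg_pos)
  define C' where "C' = max C 1"
  have C': "1 \<le> C'" "0 < C'" by (auto simp: C'_def)
  have bb': "L2_normsq M f \<le> C' * L2_normsq M (R c f)" if "f \<in> L2 M" for f
  proof -
    have "L2_normsq M f \<le> C * L2_normsq M (R c f)" using bb that unfolding bounded_below_def by blast
    also have "\<dots> \<le> C' * L2_normsq M (R c f)" by (intro mult_right_mono L2_normsq_nonneg) (simp add: C'_def)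
    finally show ?thesis .
  qed
  define t where "t = 1 / K"
  have t: "0 < t" "t \<le> 1" "t * K = 1" using K by (auto simp: t_def)
  \<comment> \<open>Since \<open>t * K = 1\<close>, the squared norm of \<open>B h\<close> is at
    most that of \<open>h\<close> minus \<open>t\<close> times that of \<open>R c h\<close>; the
    bound from below turns this into the factor \<open>1 - t / C'\<close>. The maximum in
    \<open>C'\<close> and \<open>t \<le> 1\<close> keep \<open>q\<close> nonnegative.\<close>
  define q where "q = 1 - t / C'"
  have q: "0 \<le> q" "q < 1" using t C' by (auto simp: q_def divide_le_eq)
  define B where "B h x = h x - of_real t * R (cnj c) (R c h) x" for h :: "'a \<Rightarrow> complex" and x
  have B_L2: "B h \<in> L2 M" if "h \<in> L2 M" for h
    unfolding B_def by (intro L2_diff L2_scale R_L2 that)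
  have B_contr: "L2_normsq M (B h) \<le> q * L2_normsq M h" if h: "h \<in> L2 M" for h
  proof -
    let ?n = "L2_normsq M (R c h)"
    have "L2_normsq M (B h) = L2_normsq M h
       - 2 * Re (L2_inner M h (\<lambda>x. of_real t * R (cnj c) (R c h) x)) + t\<^sup>2 * L2_normsq M (R (cnj c) (R c h))"
      unfolding B_def by (subst L2_normsq_diff) (auto intro: h L2_scale R_L2 simp: L2_normsq_scale)
    also have "L2_inner M h (\<lambda>x. of_real t * R (cnj c) (R c h) x) = of_real (t * ?n)"
      using R_adjoint[OF h R_L2[OF h, of c], of c] by (simp add: L2_inner_scale_right L2_inner_self)
    also have "L2_normsq M (R (cnj c) (R c h)) \<le> K * ?n"
      using R_bounded[OF R_L2[OF h, of c], of "cnj c"] by (simp add: K_def)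
    finally have "L2_normsq M (B h) \<le> L2_normsq M h - 2 * (t * ?n) + t\<^sup>2 * (K * ?n)"
      by (simp add: mult_left_mono)
    also have "t\<^sup>2 * (K * ?n) = t * ?n" using t(3) by (simp add: power2_eq_square algebra_simps)
    finally have "L2_normsq M (B h) \<le> L2_normsq M h - t * ?n" by simp
    also have "t * ?n \<ge> t * (L2_normsq M h / C')"
      using bb'[OF h] t C' by (intro mult_left_mono) (auto simp: divide_le_eq mult.commute)
    then have "L2_normsq M h - t * ?n \<le> q * L2_normsq M h" by (simp add: q_def algebra_simps)
    finally show ?thesis .
  qed
  \<comment> \<open>These are the terms of the Neumann series for the inverse of
    \<open>R\<^sup>* R\<close> applied to \<open>R\<^sup>* g\<close>, with \<open>R (cnj c)\<close>
    as adjoint. Telescoping shows that the sum solves \<open>R\<^sup>* R f = R\<^sup>* g\<close>,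
    and \<open>R\<^sup>*\<close> is then cancelled by injectivity.\<close>
  define h where "h n = (B ^^ n) (\<lambda>x. of_real t * R (cnj c) g x)" for n
  have h_Suc: "h (Suc n) = B (h n)" for n by (simp add: h_def)
  have h_L2: "h n \<in> L2 M" for n
  proof (induction n)
    case 0 then show ?case by (simp add: h_def L2_scale R_L2 g)
  qed (simp add: h_Suc B_L2)
  have h_bound: "L2_normsq M (h n) \<le> q ^ n * L2_normsq M (h 0)" for n
  proof (induction n)
    case (Suc n)
    have "L2_normsq M (h (Suc n)) \<le> q * L2_normsq M (h n)" unfolding h_Suc by (rule B_contr[OF h_L2])
    also have "\<dots> \<le> q * (q ^ n * L2_normsq M (h 0))" by (rule mult_left_mono[OF Suc q(1)])
    finally show ?case by simp
  qed simp
  obtain f where f: "f \<in> L2 M" "AE x in M. (\<lambda>n. h n x) sums f x"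
    by (rule L2_summable_geometric[OF h_L2 q h_bound])
  have "AE x in M. R (cnj c) (R c f) x = R (cnj c) g x"
    using R_sums[OF R_sums[OF f(2), of c], of "cnj c"] f(2)
  proof eventually_elim
    case (elim x)
    have "(\<lambda>n. h n x) \<longlonglongrightarrow> 0" using elim(2) by (intro summable_LIMSEQ_zero) (rule sums_summable)
    then have "(\<lambda>n. h n x - h (Suc n) x) sums (h 0 x - 0)" by (rule telescope_sums')
    then have "(\<lambda>n. of_real t * R (cnj c) (R c (h n)) x) sums (of_real t * R (cnj c) g x)"
      by (simp add: h_Suc B_def) (simp add: h_def)
    moreover have "(\<lambda>n. of_real t * R (cnj c) (R c (h n)) x) sums (of_real t * R (cnj c) (R c f) x)"
      by (rule sums_mult[OF elim(1)])
    ultimately show ?case using sums_unique2 t(1) by fastforce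
  qed
  then have "AE x in M. R c f x = g x"
    by (rule bounded_below_injective'[OF bounded_below_cnj[OF bb] R_L2[OF f(1)] g])
  with f(1) show ?thesis by (rule that)
qed

text \<open>The bound on \<open>S\<close> concerns members of \<open>L2 M\<close>, and
  \<open>T' f\<close> is only known to agree with \<open>T f\<close> almost everywhere. So the
  estimate is taken at \<open>S (R c f)\<close>, which injectivity of \<open>R c\<close> identifies
  with \<open>f\<close>. Injectivity follows from surjectivity: the kernel of \<open>R c\<close> is
  orthogonal to the range of \<open>R (cnj c)\<close>, and by conjugation that range is
  everything.\<close>

lemma bounded_below_of_bounded_inverse:
  assumes T': "AE x in M. \<forall>f. T' f x = T f x"
    and inv: "has_bounded_inverse_L2 M (\<lambda>f x. T' f x - c * f x)"
  obtains C where "bounded_below c C"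
proof -
  obtain S C where S: "\<And>f. f \<in> L2 M \<Longrightarrow> S f \<in> L2 M"
    "\<And>f. f \<in> L2 M \<Longrightarrow> ae_eq M (\<lambda>x. T' (S f) x - c * S f x) f"
    "\<And>f. f \<in> L2 M \<Longrightarrow> L2_normsq M (S f) \<le> C * L2_normsq M f"
    using inv unfolding has_bounded_inverse_L2_def by blast
  have RS: "AE x in M. R c (S f) x = f x" if "f \<in> L2 M" for f
    using S(2)[OF that, unfolded ae_eq_def] T' by eventually_elim (simp add: R_def)
  have inj: "AE x in M. h x = 0" if h: "h \<in> L2 M" "AE x in M. R c h x = 0" for h
  proof -
    define v where "v = (\<lambda>x. cnj (S (\<lambda>x. cnj (h x)) x))"
    have v: "v \<in> L2 M" unfolding v_def by (intro L2_cnj S h)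
    have "AE x in M. h x = R (cnj c) v x"
      using RS[OF L2_cnj[OF h(1)]] unfolding v_def R_cnj by eventually_elim simp
    then have "L2_inner M h h = L2_inner M h (R (cnj c) v)"
      using h(1) v by (intro L2_inner_cong_AE L2_measurable R_L2) auto
    also have "\<dots> = L2_inner M (R c h) v" by (rule R_adjoint[OF h(1) v, symmetric])
    also have "\<dots> = L2_inner M (\<lambda>_. 0) v"
      using h v by (intro L2_inner_cong_AE L2_measurable R_L2) (auto simp: L2_def)
    also have "\<dots> = 0" by (simp add: L2_inner_def)
    finally show ?thesis using L2_normsq_eq_0_iff[OF h(1)] by (simp add: L2_inner_self)
  qed
  have "bounded_below c C"
    unfolding bounded_below_def
  proof
    fix f assume f: "f \<in> L2 M"
    have Rf: "R c f \<in> L2 M" by (rule R_L2[OF f])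
    have "AE x in M. R c (\<lambda>x. S (R c f) x - f x) x = 0"
      using RS[OF Rf] by eventually_elim (subst R_diff, simp)
    from inj[OF L2_diff(1)[OF S(1)[OF Rf] f] this]
    have "AE x in M. f x = S (R c f) x" by eventually_elim simp
    then have "L2_normsq M f = L2_normsq M (S (R c f))"
      using f S(1)[OF Rf] by (intro L2_normsq_cong_AE L2_measurable)
    then show "L2_normsq M f \<le> C * L2_normsq M (R c f)" using S(3)[OF Rf] by simp
  qed
  then show ?thesis by (rule that)
qed

text \<open>For \<open>f \<in> L2 M\<close> the function \<open>T' f\<close> need not be Borel on the exceptional null set, so the
  inverse is chosen uniformly for all functions, not only for those in \<open>L2 M\<close>.\<close>

lemma bounded_inverse_of_bounded_below:
  assumes T': "AE x in M. \<forall>f. T' f x = T f x" and bb: "bounded_below c C"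
  shows "has_bounded_inverse_L2 M (\<lambda>f x. T' f x - c * f x)"
proof -
  define S where "S g = (SOME f. f \<in> L2 M \<and> (AE x in M. R c f x = g x))" for g
  have S: "S g \<in> L2 M \<and> (AE x in M. R c (S g) x = g x)"
    if "f \<in> L2 M" "AE x in M. R c f x = g x" for f g
    using someI[of "\<lambda>f. f \<in> L2 M \<and> (AE x in M. R c f x = g x)" f] that unfolding S_def by blast
  have S_L2: "S g \<in> L2 M" "AE x in M. R c (S g) x = g x" if "g \<in> L2 M" for g
    using S bounded_below_surjective[OF bb that] by metis+
  show ?thesis
    unfolding has_bounded_inverse_L2_def ae_eq_def
  proof (intro exI[of _ S] conjI ballI impI exI[of _ C])
    fix g assume g: "g \<in> L2 M"
    show "S g \<in> L2 M" by (rule S_L2[OF g])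
    show "AE x in M. T' (S g) x - c * S g x = g x"
      using S_L2(2)[OF g] T' by eventually_elim (simp add: R_def)
    have "L2_normsq M (S g) \<le> C * L2_normsq M (R c (S g))"
      using bb S_L2(1)[OF g] unfolding bounded_below_def by blast
    also have "L2_normsq M (R c (S g)) = L2_normsq M g"
      using S_L2[OF g] g by (intro L2_normsq_cong_AE L2_measurable R_L2)
    finally show "L2_normsq M (S g) \<le> C * L2_normsq M g" .
  next
    fix f g assume f: "f \<in> L2 M" and g: "g \<in> L2 M" and fg: "AE x in M. f x = g x"
    have "AE x in M. R c (S f) x = R c (S g) x"
      using S_L2(2)[OF f] S_L2(2)[OF g] fg by eventually_elim simp
    then show "AE x in M. S f x = S g x"
      by (rule bounded_below_injective'[OF bb S_L2(1)[OF f] S_L2(1)[OF g]])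
  next
    fix f assume f: "f \<in> L2 M"
    let ?g = "\<lambda>x. T' f x - c * f x"
    have Rf: "AE x in M. R c f x = ?g x" using T' by eventually_elim (simp add: R_def)
    have Sg: "S ?g \<in> L2 M" "AE x in M. R c (S ?g) x = ?g x" using S[OF f Rf] by blast+
    have "AE x in M. R c (S ?g) x = R c f x" using Sg(2) Rf by eventually_elim simp
    then show "AE x in M. S ?g x = f x"
      by (rule bounded_below_injective'[OF bb Sg(1) f])
  qed
qed

end

section \<open>Symmetry of the spectrum\<close>

context partial_isos
begin

text \<open>Where \<open>x\<close> and all its images \<open>\<theta> k x\<close> lie in
  \<open>U \<union> V\<close>, the sign flips along every edge, so \<open>R c (s f)\<close> and
  \<open>R (- c) f\<close> have equal modulus. The remaining error is the integral of one fixed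
  integrable function over a bad set. The maximum with 0 allows multiplying inequalities by the
  constant.\<close>

lemma bounded_below_uminus:
  assumes bb: "bounded_below c C"
    and bip: "\<And>\<epsilon>. \<epsilon> > 0 \<Longrightarrow> \<exists>U V. U \<in> sets M \<and> V \<in> sets M \<and> U \<inter> V = {} \<and> measure M (space M - (U \<union> V)) < \<epsilon> \<and>
      (\<forall>k\<in>I. \<forall>x\<in>A k. \<not> (x \<in> U \<and> \<theta> k x \<in> U) \<and> \<not> (x \<in> V \<and> \<theta> k x \<in> V))"
  shows "bounded_below (- c) (max C 0)"
  unfolding bounded_below_def
proof
  fix f assume f: "f \<in> L2 M"
  note [measurable] = L2_measurable[OF f]
  define C' where "C' = max C 0"
  \<comment> \<open>Errors \<open>(1/2) ^ n\<close> are summable, so by Borel-Cantelli almost every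
    point lies in only finitely many of the bad sets below, as dominated convergence will
    need.\<close>
  have "\<exists>p. fst p \<in> sets M \<and> snd p \<in> sets M \<and> fst p \<inter> snd p = {} \<and> measure M (space M - (fst p \<union> snd p)) < (1/2) ^ n \<and>
      (\<forall>k\<in>I. \<forall>x\<in>A k. \<not> (x \<in> fst p \<and> \<theta> k x \<in> fst p) \<and> \<not> (x \<in> snd p \<and> \<theta> k x \<in> snd p))" for n :: nat
    using bip[of "(1/2) ^ n"] by force
  then obtain p where p: "\<And>n. fst (p n) \<in> sets M \<and> snd (p n) \<in> sets M \<and> fst (p n) \<inter> snd (p n) = {} \<and>
      measure M (space M - (fst (p n) \<union> snd (p n))) < (1/2) ^ n \<and>
      (\<forall>k\<in>I. \<forall>x\<in>A k. \<not> (x \<in> fst (p n) \<and> \<theta> k x \<in> fst (p n)) \<and> \<not> (x \<in> snd (p n) \<and> \<theta> k x \<in> snd (p n)))"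
    by metis
  define U V where "U n = fst (p n)" and "V n = snd (p n)" for n
  have [measurable]: "U n \<in> sets M" "V n \<in> sets M" for n using p unfolding U_def V_def by blast+
  have disj: "U n \<inter> V n = {}" and small: "measure M (space M - (U n \<union> V n)) < (1/2) ^ n" for n
    using p unfolding U_def V_def by blast+
  have indep: "\<not> (x \<in> U n \<and> \<theta> k x \<in> U n) \<and> \<not> (x \<in> V n \<and> \<theta> k x \<in> V n)" if "k \<in> I" "x \<in> A k" for n k x
    using p that unfolding U_def V_def by blast
  \<comment> \<open>A point is bad if it or one of its images leaves
    \<open>U n \<union> V n\<close>. Intersecting with \<open>A (inv k)\<close> brings the second
    part into the form of \<open>preserves\<close>, so each index contributes no more than the
    complement of \<open>U n \<union> V n\<close>.\<close>
  define Bad where "Bad n = (space M - (U n \<union> V n)) \<union> (\<Union>k\<in>I. \<theta> k -` (A (inv k) - (U n \<union> V n)) \<inter> A k)" for n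
  have pre: "\<theta> k -` (A (inv k) - (U n \<union> V n)) \<inter> A k \<in> sets M"
    and pre_small: "measure M (\<theta> k -` (A (inv k) - (U n \<union> V n)) \<inter> A k) \<le> (1/2) ^ n" if k: "k \<in> I" for k n
  proof -
    have "\<theta> k -` (A (inv k) - (U n \<union> V n)) \<inter> A k = (\<theta> k -` (A (inv k) - (U n \<union> V n)) \<inter> space M) \<inter> A k"
      using sets.sets_into_space[OF A] by blast
    moreover have "\<theta> k -` (A (inv k) - (U n \<union> V n)) \<inter> space M \<in> sets M"
      by (rule measurable_sets[OF \<theta>]) measurable
    ultimately show "\<theta> k -` (A (inv k) - (U n \<union> V n)) \<inter> A k \<in> sets M" using A by simp
    have "measure M (\<theta> k -` (A (inv k) - (U n \<union> V n)) \<inter> A k) = measure M (A (inv k) - (U n \<union> V n))"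
      using preserves[OF k, of "A (inv k) - (U n \<union> V n)"] by (simp add: measure_def)
    also have "\<dots> \<le> measure M (space M - (U n \<union> V n))"
      using sets.sets_into_space[OF A, of "inv k"] by (intro finite_measure_mono) auto
    finally show "measure M (\<theta> k -` (A (inv k) - (U n \<union> V n)) \<inter> A k) \<le> (1/2) ^ n" using small[of n] by simp
  qed
  have Bad[measurable]: "Bad n \<in> sets M" for n
    unfolding Bad_def using pre finite_I by (intro sets.Un sets.finite_UN) auto
  have Bad_small: "measure M (Bad n) \<le> (1 + card I) * (1/2) ^ n" for n
  proof -
    have "measure M (Bad n) \<le> measure M (space M - (U n \<union> V n))
        + measure M (\<Union>k\<in>I. \<theta> k -` (A (inv k) - (U n \<union> V n)) \<inter> A k)"
      unfolding Bad_def using pre finite_I by (intro measure_Un_le sets.finite_UN) auto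
    also have "measure M (\<Union>k\<in>I. \<theta> k -` (A (inv k) - (U n \<union> V n)) \<inter> A k)
        \<le> (\<Sum>k\<in>I. measure M (\<theta> k -` (A (inv k) - (U n \<union> V n)) \<inter> A k))"
      using pre finite_I by (intro finite_measure_subadditive_finite) auto
    also have "\<dots> \<le> (\<Sum>k\<in>I. (1/2) ^ n)" by (intro sum_mono pre_small)
    finally show ?thesis using small[of n] by (simp add: algebra_simps)
  qed
  have "summable (\<lambda>n. (1 + card I) * (1/2 :: real) ^ n)"
    by (intro summable_mult summable_geometric) simp
  then have "summable (\<lambda>n. measure M (Bad n))"
    by (rule summable_comparison_test'[of _ 0]) (use Bad_small in simp)
  then have Bad_ev: "AE x in M. eventually (\<lambda>n. x \<in> space M - Bad n) sequentially"
    by (intro borel_cantelli_AE1) (auto simp: emeasure_eq_measure)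
  \<comment> \<open>\<open>Fb\<close> dominates the squared modulus of \<open>R c g\<close> for
    every \<open>g\<close> dominated by \<open>f\<close>, hence for \<open>s f\<close> whatever the
    sets are. \<open>H\<close> below adds the mass that \<open>f\<close> loses on the bad set when
    it is multiplied by \<open>s\<close>.\<close>
  define Fb where "Fb x = 2 * energy f x + 2 * (cmod c)\<^sup>2 * (cmod (f x))\<^sup>2" for x
  have Fb_int: "integrable M Fb"
    unfolding Fb_def using energy_integrable(1)[OF f] L2_integrable[OF f]
    by (intro Bochner_Integration.integrable_add integrable_mult_right) auto
  define H where "H x = C' * Fb x + (cmod (f x))\<^sup>2" for x
  have H_int: "integrable M H"
    unfolding H_def by (intro Bochner_Integration.integrable_add integrable_mult_right Fb_int L2_integrable[OF f])
  have main: "L2_normsq M f \<le> C' * L2_normsq M (R (- c) f) + (\<integral>x. indicat_real (Bad n) x * H x \<partial>M)" for n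
  proof -
    define s where "s x = indicat_real (U n) x - indicat_real (V n) x" for x
    define g where "g x = of_real (s x) * f x" for x
    have s: "\<bar>s x\<bar> \<le> 1" for x using disj[of n] by (auto simp: s_def indicator_def)
    have g_le: "cmod (g x) \<le> cmod (f x)" for x
      using mult_right_mono[OF s norm_ge_zero] by (simp add: g_def norm_mult)
    have g_meas: "g \<in> borel_measurable M" unfolding g_def s_def by measurable
    have g: "g \<in> L2 M"
      by (rule L2_dominated[OF g_meas L2_integrable[OF f]]) (intro power_mono g_le norm_ge_zero)
    have Rg: "(cmod (R c g x))\<^sup>2 \<le> (cmod (R (- c) f x))\<^sup>2
        + indicat_real (Bad n) x * Fb x" if x: "x \<in> space M" for x
    proof (cases "x \<in> Bad n")
      case True
      have "(cmod (R c g x))\<^sup>2 \<le> 2 * (cmod (T g x))\<^sup>2 + 2 * (cmod (c * g x))\<^sup>2"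
        using cmod_add_sq_le[of "T g x" "- (c * g x)"] by (simp add: R_def)
      also have "(cmod (T g x))\<^sup>2 \<le> energy g x" by (rule cmod_T_le)
      also have "energy g x \<le> energy f x"
        unfolding energy_def
        by (intro mult_left_mono sum_mono scaleR_left_mono power_mono g_le) auto
      also have "(cmod (c * g x))\<^sup>2 \<le> (cmod c)\<^sup>2 * (cmod (f x))\<^sup>2"
        unfolding norm_mult power_mult_distrib by (intro mult_left_mono power_mono g_le) auto
      finally have "(cmod (R c g x))\<^sup>2 \<le> 2 * energy f x + 2 * (cmod c)\<^sup>2 * (cmod (f x))\<^sup>2" by simp
      then show ?thesis using True by (simp add: add_increasing Fb_def)
    next
      case False
      then have good: "\<theta> k x \<in> U n \<union> V n" if "k \<in> I" "x \<in> A k" for k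
        using that \<theta>_inv[OF that] unfolding Bad_def by blast
      from False x have "x \<in> U n \<union> V n" unfolding Bad_def by blast
      then have "s x = 1 \<or> s x = -1" using disj[of n] by (auto simp: s_def indicator_def)
      have "s (\<theta> k x) = - s x" if "k \<in> I" "x \<in> A k" for k
        using good[OF that] indep[OF that, of n] \<open>x \<in> U n \<union> V n\<close> disj[of n]
        by (auto simp: s_def indicator_def)
      then have "T g x = - of_real (s x) * T f x"
        unfolding T_def sum_distrib_left by (intro sum.cong refl) (auto simp: g_def indicator_def)
      then have "R c g x = - of_real (s x) * R (- c) f x"
        by (simp add: R_def g_def algebra_simps)
      with \<open>s x = 1 \<or> s x = -1\<close> have "cmod (R c g x) = cmod (R (- c) f x)" by (auto simp: norm_mult)
      with False show ?thesis by simp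
    qed
    have int1: "integrable M (\<lambda>x. (cmod (R (- c) f x))\<^sup>2)" by (rule L2_integrable[OF R_L2[OF f]])
    have int2: "integrable M (\<lambda>x. indicat_real (Bad n) x * Fb x)"
      using integrable_real_mult_indicator[OF Bad Fb_int] by (simp only: mult.commute)
    have int3: "integrable M (\<lambda>x. indicat_real (Bad n) x * (cmod (f x))\<^sup>2)"
      using integrable_real_mult_indicator[OF Bad L2_integrable[OF f]] by (simp only: mult.commute)
    have "L2_normsq M f \<le> (\<integral>x. (cmod (g x))\<^sup>2 + indicat_real (Bad n) x * (cmod (f x))\<^sup>2 \<partial>M)"
      unfolding L2_normsq_def
    proof (intro integral_mono Bochner_Integration.integrable_add L2_integrable f g int3)
      fix x assume x: "x \<in> space M"
      show "(cmod (f x))\<^sup>2 \<le> (cmod (g x))\<^sup>2 + indicat_real (Bad n) x * (cmod (f x))\<^sup>2"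
      proof (cases "x \<in> Bad n")
        case False
        then have "x \<in> U n \<union> V n" using x unfolding Bad_def by blast
        then have "s x = 1 \<or> s x = -1" using disj[of n] by (auto simp: s_def indicator_def)
        then show ?thesis by (auto simp: g_def)
      qed simp
    qed
    also have "\<dots> = L2_normsq M g + (\<integral>x. indicat_real (Bad n) x * (cmod (f x))\<^sup>2 \<partial>M)"
      unfolding L2_normsq_def by (rule Bochner_Integration.integral_add[OF L2_integrable[OF g] int3])
    also have "L2_normsq M g \<le> C' * L2_normsq M (R c g)"
      using bb g L2_normsq_nonneg[of M "R c g"] unfolding bounded_below_def C'_def
      by (metis max.cobounded1 mult_right_mono order_trans)
    also have "L2_normsq M (R c g) \<le> (\<integral>x. (cmod (R (- c) f x))\<^sup>2
        + indicat_real (Bad n) x * Fb x \<partial>M)"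
      unfolding L2_normsq_def
      by (intro integral_mono Bochner_Integration.integrable_add L2_integrable R_L2 g int1 int2 Rg)
    also have "\<dots> = L2_normsq M (R (- c) f)
        + (\<integral>x. indicat_real (Bad n) x * Fb x \<partial>M)"
      unfolding L2_normsq_def by (rule Bochner_Integration.integral_add[OF int1 int2])
    finally have "L2_normsq M f \<le> C' * (L2_normsq M (R (- c) f)
        + (\<integral>x. indicat_real (Bad n) x * Fb x \<partial>M))
        + (\<integral>x. indicat_real (Bad n) x * (cmod (f x))\<^sup>2 \<partial>M)"
      by (simp add: C'_def mult_left_mono)
    also have "\<dots> = C' * L2_normsq M (R (- c) f) + (\<integral>x. C' * (indicat_real (Bad n) x * Fb x)
        + indicat_real (Bad n) x * (cmod (f x))\<^sup>2 \<partial>M)"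
      by (subst Bochner_Integration.integral_add[OF integrable_mult_right[OF int2] int3]) (simp add: distrib_left)
    also have "(\<integral>x. C' * (indicat_real (Bad n) x * Fb x)
        + indicat_real (Bad n) x * (cmod (f x))\<^sup>2 \<partial>M) = (\<integral>x. indicat_real (Bad n) x * H x \<partial>M)"
      by (intro Bochner_Integration.integral_cong refl) (simp add: H_def algebra_simps)
    finally show ?thesis .
  qed
  have "(\<lambda>n. \<integral>x. indicat_real (Bad n) x * H x \<partial>M) \<longlonglongrightarrow> (\<integral>x. 0 \<partial>M)"
  proof (rule integral_dominated_convergence[where w = "\<lambda>x. norm (H x)"])
    show "(\<lambda>x. indicat_real (Bad n) x * H x) \<in> borel_measurable M" for n
      using borel_measurable_integrable[OF H_int] by measurable
    show "AE x in M. (\<lambda>n. indicat_real (Bad n) x * H x) \<longlonglongrightarrow> 0"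
      using Bad_ev
    proof eventually_elim
      case (elim x)
      then have "eventually (\<lambda>n. indicat_real (Bad n) x * H x = 0) sequentially"
        by eventually_elim simp
      then show ?case by (rule tendsto_eventually)
    qed
  qed (use H_int in \<open>auto simp: indicator_def\<close>)
  then have "(\<lambda>n. C' * L2_normsq M (R (- c) f) + (\<integral>x. indicat_real (Bad n) x * H x \<partial>M)) \<longlonglongrightarrow> C' * L2_normsq M (R (- c) f) + 0"
    by (intro tendsto_intros) simp
  then show "L2_normsq M f \<le> max C 0 * L2_normsq M (R (- c) f)"
    using LIMSEQ_le_const main unfolding C'_def[symmetric] by fastforce
qed

end

text \<open>An edge from \<open>x\<close> to \<open>y\<close> is labelled by the pair
  \<open>(i, j)\<close> with \<open>y = f i x\<close> and \<open>x = f j y\<close>; reversing the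
  edge swaps the pair, which gives the involution. Labels are unique because distinct selectors
  differ at common points. The label \<open>j\<close> exists if the enumeration is complete at
  \<open>y\<close> as well as at \<open>x\<close>, and \<open>pmp_graph_avoids_null\<close> secures
  this for almost every \<open>x\<close>.\<close>

lemma graph_partial_isos:
  fixes M :: "'a::polish_space measure"
  assumes M: "finite_measure M" "sets M = sets borel"
    and bg: "borel_graph M E" and bd: "bounded_degree M E" and pmp: "pmp_graph M E"
  obtains I :: "(nat \<times> nat) set" and A \<theta> inv
  where "partial_isos M I A \<theta> inv" "\<forall>k. \<forall>x\<in>A k. E x (\<theta> k x)"
    "AE x in M. \<forall>g. adj_op E g x = partial_isos.T I A \<theta> g x"
proof -
  interpret finite_measure M by fact
  note [measurable_cong] = M(2)
  have G: "simple_graph E" using bg by (simp add: borel_graph_def)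
  have sym: "E x y \<Longrightarrow> E y x" for x y using G by (simp add: simple_graph_def)
  define ES where "ES = {(x, y). E x y}"
  have ES: "ES \<in> sets borel"
    using bg sets_pair_measure_cong[OF M(2) M(2)] unfolding borel_graph_def ES_def borel_prod[symmetric] by simp
  have nb: "ES `` {x} = nbhd E x" for x by (auto simp: ES_def nbhd_def)
  obtain d :: nat where "AE x in M. finite (ES `` {x}) \<and> card (ES `` {x}) \<le> d"
    using bd unfolding bounded_degree_def nb by blast
  from enumerate_bounded_sections[OF M ES this] obtain D f where
    Df: "\<forall>i. D i \<in> sets borel \<and> f i \<in> borel_measurable borel \<and> (\<forall>x\<in>D i. (x, f i x) \<in> ES)"
    and inj: "\<forall>i j x. x \<in> D i \<longrightarrow> x \<in> D j \<longrightarrow> f i x = f j x \<longrightarrow> i = j"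
    and cover: "AE x in M. \<forall>y. (x, y) \<in> ES \<longrightarrow> (\<exists>i<d. x \<in> D i \<and> y = f i x)" by blast
  have [measurable]: "D i \<in> sets borel" "f i \<in> borel_measurable borel" for i using Df by blast+
  have edge: "E x (f i x)" if "x \<in> D i" for i x using Df that by (auto simp: ES_def)
  define I where "I = {..<d} \<times> {..<d}"
  define A where "A k = {x \<in> space borel. x \<in> D (fst k) \<and> f (fst k) x \<in> D (snd k) \<and> f (snd k) (f (fst k) x) = x}" for k
  define \<theta> where "\<theta> k = f (fst k)" for k :: "nat \<times> nat"
  have A_meas[measurable]: "A k \<in> sets borel" for k unfolding A_def by measurable
  have \<theta>_meas: "\<theta> k \<in> borel_measurable borel" for k unfolding \<theta>_def by simp
  have A_edge: "E x (\<theta> k x)" if "x \<in> A k" for k x using that edge by (auto simp: A_def \<theta>_def)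
  have \<theta>_swap: "\<theta> k x \<in> A (prod.swap k) \<and> \<theta> (prod.swap k) (\<theta> k x) = x" if "x \<in> A k" for k x
    using that by (auto simp: A_def \<theta>_def)
  have iso: "partial_isos M I A \<theta> prod.swap"
  proof (rule partial_isos.intro[OF M(1)], unfold_locales)
    show "finite I" by (simp add: I_def)
    show "A k \<in> sets M" for k using M(2) by simp
    show "\<theta> k \<in> M \<rightarrow>\<^sub>M M" for k
      using \<theta>_meas[of k] measurable_cong_sets[OF M(2) M(2)] by blast
    show "prod.swap k \<in> I" if "k \<in> I" for k using that by (auto simp: I_def)
    show "prod.swap (prod.swap k) = k" for k :: "nat \<times> nat" by simp
    show "\<theta> k x \<in> A (prod.swap k) \<and> \<theta> (prod.swap k) (\<theta> k x) = x" if "x \<in> A k" for k x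
      using \<theta>_swap[OF that] .
    fix k C assume C: "C \<in> sets M" "C \<subseteq> A (prod.swap k)"
    have "bij_betw (\<theta> k) (A k) (A (prod.swap k))"
      using \<theta>_swap[of _ k] \<theta>_swap[of _ "prod.swap k"]
      by (intro bij_betwI[where g = "\<theta> (prod.swap k)"]) auto
    moreover have "\<forall>x\<in>A k. E\<^sup>*\<^sup>* x (\<theta> k x)" using A_edge by (blast intro: r_into_rtranclp)
    ultimately have "partial_borel_bij_in M E (\<theta> k) (A k) (A (prod.swap k))"
      unfolding partial_borel_bij_in_def M(2) using A_meas measurable_sets_borel[OF \<theta>_meas] by blast
    then have "measure M (\<theta> k -` C \<inter> A k) = measure M C" using pmp C unfolding pmp_graph_def by blast
    then show "emeasure M (\<theta> k -` C \<inter> A k) = emeasure M C" by (simp add: emeasure_eq_measure)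
  qed
  interpret iso: partial_isos M I A \<theta> prod.swap by (rule iso)
  obtain N where N: "{x \<in> space M. \<not> (\<forall>y. (x, y) \<in> ES \<longrightarrow> (\<exists>i<d. x \<in> D i \<and> y = f i x))} \<subseteq> N" "N \<in> null_sets M"
    using cover unfolding eventually_ae_filter by blast
  have coverN: "\<exists>i<d. x \<in> D i \<and> y = f i x" if "x \<notin> N" "E x y" for x y
    using N(1) that sets_eq_imp_space_eq[OF M(2)] by (auto simp: ES_def)
  have "AE x in M. \<forall>i. x \<in> D i \<longrightarrow> f i x \<notin> N"
  proof (subst AE_all_countable, rule allI)
    show "AE x in M. x \<in> D i \<longrightarrow> f i x \<notin> N" for i
      using pmp_graph_avoids_null[OF M pmp G _ _ _ N(2), of "D i" "f i"] edge by simp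
  qed
  with AE_not_in[OF N(2)] have "AE x in M. \<forall>g. adj_op E g x = iso.T g x"
  proof eventually_elim
    case (elim x)
    show ?case
    proof
      fix g
      let ?J = "{i. i < d \<and> x \<in> D i}"
      have "nbhd E x = (\<lambda>i. f i x) ` ?J"
        using coverN[OF elim(1)] edge by (auto simp: nbhd_def)
      moreover have "inj_on (\<lambda>i. f i x) ?J" using inj by (auto intro: inj_onI)
      ultimately have "adj_op E g x = (\<Sum>i\<in>?J. g (f i x))"
        unfolding adj_op_def by (simp add: sum.reindex)
      also have "\<dots> = (\<Sum>i<d. if x \<in> D i then g (f i x) else 0)"
        by (rule sum.mono_neutral_cong_left) auto
      also have "\<dots> = (\<Sum>i<d. \<Sum>j<d. indicat_real (A (i, j)) x *\<^sub>R g (\<theta> (i, j) x))"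
      proof (intro sum.cong refl)
        fix i assume "i \<in> {..<d}"
        show "(if x \<in> D i then g (f i x) else 0) = (\<Sum>j<d. indicat_real (A (i, j)) x *\<^sub>R g (\<theta> (i, j) x))"
        proof (cases "x \<in> D i")
          case True
          then have "E (f i x) x" "f i x \<notin> N" using edge sym elim(2) by auto
          then obtain j where j: "j < d" "f i x \<in> D j" "x = f j (f i x)" using coverN by blast
          have "x \<in> A (i, j') \<longleftrightarrow> j' = j" for j'
            using True j inj by (auto simp: A_def)
          then have "(\<Sum>j'<d. indicat_real (A (i, j')) x *\<^sub>R g (\<theta> (i, j') x)) = (\<Sum>j'<d. if j' = j then g (f i x) else 0)"
            by (intro sum.cong refl) (simp add: indicator_def \<theta>_def)
          also have "\<dots> = g (f i x)" using j(1) by simp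
          finally show ?thesis using True by simp
        next
          case False
          then show ?thesis by (simp add: A_def)
        qed
      qed
      also have "\<dots> = iso.T g x"
        unfolding sum.cartesian_product I_def[symmetric] iso.T_def by (intro sum.cong refl) auto
      finally show "adj_op E g x = iso.T g x" .
    qed
  qed
  then show ?thesis using A_edge by (intro that[OF iso]) auto
qed

theorem theorem4p4:
  fixes M :: "'a::polish_space measure" and E :: "'a \<Rightarrow> 'a \<Rightarrow> bool" and c :: complex
  assumes "prob_space M"
    and "sets M = sets borel"
    and "borel_graph M E"
    and "bounded_degree M E"
    and "pmp_graph M E"
    and "approx_meas_bipartite M E"
    and "c \<in> L2_spectrum M (adj_op E)"
  shows "- c \<in> L2_spectrum M (adj_op E)"
proof (rule ccontr)
  interpret prob_space M by fact
  obtain I :: "(nat \<times> nat) set" and A \<theta> inv where iso: "partial_isos M I A \<theta> inv"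
    and edge: "\<forall>k. \<forall>x\<in>A k. E x (\<theta> k x)"
    and adj: "AE x in M. \<forall>g. adj_op E g x = partial_isos.T I A \<theta> g x"
    by (rule graph_partial_isos[OF finite_measure_axioms assms(2-5)])
  interpret iso: partial_isos M I A \<theta> inv by (rule iso)
  assume "- c \<notin> L2_spectrum M (adj_op E)"
  then have "has_bounded_inverse_L2 M (\<lambda>f x. adj_op E f x - (- c) * f x)" by (simp add: L2_spectrum_def)
  from iso.bounded_below_of_bounded_inverse[OF adj this] obtain C where C: "iso.bounded_below (- c) C" .
  have "\<exists>U V. U \<in> sets M \<and> V \<in> sets M \<and> U \<inter> V = {} \<and> measure M (space M - (U \<union> V)) < \<epsilon> \<and>
      (\<forall>k\<in>I. \<forall>x\<in>A k. \<not> (x \<in> U \<and> \<theta> k x \<in> U) \<and> \<not> (x \<in> V \<and> \<theta> k x \<in> V))" if "\<epsilon> > 0" for \<epsilon>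
  proof -
    obtain U V where UV: "U \<in> sets M" "V \<in> sets M" "U \<inter> V = {}" "independent_set E U" "independent_set E V"
      "measure M (U \<union> V) > 1 - \<epsilon>"
      using assms(6) \<open>\<epsilon> > 0\<close> unfolding approx_meas_bipartite_def by blast
    have "measure M (space M - (U \<union> V)) = 1 - measure M (U \<union> V)" using UV(1,2) by (intro prob_compl) auto
    then have "measure M (space M - (U \<union> V)) < \<epsilon>" using UV(6) by simp
    moreover have "\<forall>k\<in>I. \<forall>x\<in>A k. \<not> (x \<in> U \<and> \<theta> k x \<in> U) \<and> \<not> (x \<in> V \<and> \<theta> k x \<in> V)"
      using UV(4,5) edge unfolding independent_set_def by blast
    ultimately show ?thesis using UV by blast
  qed
  from iso.bounded_below_uminus[OF C this] have "iso.bounded_below c (max C 0)" by simp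
  then have "has_bounded_inverse_L2 M (\<lambda>f x. adj_op E f x - c * f x)"
    by (rule iso.bounded_inverse_of_bounded_below[OF adj])
  with assms(7) show False by (simp add: L2_spectrum_def)
qed

end
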